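(* Let $b_0>0$. For $b\in(0,b_0]$ and $f\in H$ put $\Gamma(\eta)=f(\eta)\sqrt{1-\eta^2}$ and define the bending moment (including the wing's own weight) $$M_{b,f}(\xi)=\frac b2\int_\xi^1\Gamma(\eta)\sin\!\Big(\frac{b(\eta-\xi)}{2}\Big)\,d\eta,\qquad \xi\in[0,1].$$ Let $\mathcal{A}_2$ be the set of pairs $(b,f)$ with $b\in(0,b_0]$, $f\in H$, $D[f]<\infty$, satisfying the lift constraint $a_0(f)=\frac{4}{\pi b}$, the weight constraint $$b\int_0^1 |M_{b,f}(\xi)|\,d\xi\le 1,$$ and the non-collapse conditions $$M_{b,f}(\xi)\ge 0\quad\text{and}\quad M_{b,f}(\xi)\ge \frac{b^2}{4}\int_\xi^1 M_{b,f}(\eta)(\eta-\xi)\,d\eta\qquad\text{for all }\xi\in[0,1].$$ Then there exists $(\tilde b,\tilde f)\in\mathcal{A}_2$ with $D[\tilde f]=\min_{(b,f)\in\mathcal{A}_2}D[f]$.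
   Context: All physical and material constants are normalized to $1$. $H$ denotes the real Hilbert space of even measurable functions $f:(-1,1)\to\mathbb{R}$ with $\int_{-1}^1 f(\xi)^2\sqrt{1-\xi^2}\,d\xi<\infty$, with inner product $(f,g)=\int_{-1}^1 fg\sqrt{1-\xi^2}\,d\xi$. $U_n$ is the Chebyshev polynomial of the second kind ($U_0=1$, $U_1=2x$, $U_{n+1}=2xU_n-U_{n-1}$), with $\int_{-1}^1U_nU_m\sqrt{1-x^2}\,dx=\frac\pi2\delta_{nm}$. For $f\in H$, $a_n(f)=\frac{2}{\pi}\int_{-1}^1 fU_n\sqrt{1-\xi^2}\,d\xi$ and the induced drag is $D[f]=\frac{\pi}{8}\sum_{m\ge0}(2m+1)a_{2m}(f)^2\in[0,\infty]$. In physical variables $x=\xi b/2$, $M_{b,f}$ is the unique solution of $M(x)=\int_x^{b/2}(\Gamma(y)-M(y))(y-x)\,dy$, i.e. the lift-induced bending moment reduced by the moment of the wing's own weight (weight per unit span proportional to $M$). *)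

theory Defs
  imports "HOL-Analysis.Analysis"
begin

fun chebU :: "nat \<Rightarrow> real \<Rightarrow> real" where
  "chebU 0 x = 1"
| "chebU (Suc 0) x = 2 * x"
| "chebU (Suc (Suc n)) x = 2 * x * chebU (Suc n) x - chebU n x"

text \<open>The space H (as a set of representatives): even measurable functions on (-1,1)
  that are square integrable w.r.t. the weight sqrt(1 - xi^2).\<close>
definition H :: "(real \<Rightarrow> real) set" where
  "H = {f. f \<in> borel_measurable (restrict_space lborel {-1<..<1})
          \<and> (\<forall>\<xi>\<in>{-1<..<1}. f (-\<xi>) = f \<xi>)
          \<and> integrable (restrict_space lborel {-1<..<1}) (\<lambda>\<xi>. (f \<xi>)\<^sup>2 * sqrt (1 - \<xi>\<^sup>2))}"

definition coef :: "nat \<Rightarrow> (real \<Rightarrow> real) \<Rightarrow> real" where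
  "coef n f = 2 / pi * (LINT \<xi>:{-1<..<1}|lborel. f \<xi> * chebU n \<xi> * sqrt (1 - \<xi>\<^sup>2))"

definition drag :: "(real \<Rightarrow> real) \<Rightarrow> ennreal" where
  "drag f = (\<Sum>m. ennreal (pi / 8 * (2 * real m + 1) * (coef (2 * m) f)\<^sup>2))"

definition Mbf :: "real \<Rightarrow> (real \<Rightarrow> real) \<Rightarrow> real \<Rightarrow> real" where
  "Mbf b f \<xi> = b / 2 * (LINT \<eta>:{\<xi>..1}|lborel.
       f \<eta> * sqrt (1 - \<eta>\<^sup>2) * sin (b * (\<eta> - \<xi>) / 2))"

definition A2 :: "real \<Rightarrow> (real \<times> (real \<Rightarrow> real)) set" where
  "A2 b0 = {(b, f). b \<in> {0<..b0} \<and> f \<in> H \<and> drag f < top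
      \<and> coef 0 f = 4 / (pi * b)
      \<and> b * (LINT \<xi>:{0..1}|lborel. \<bar>Mbf b f \<xi>\<bar>) \<le> 1
      \<and> (\<forall>\<xi>\<in>{0..1}. Mbf b f \<xi> \<ge> 0
            \<and> Mbf b f \<xi> \<ge> b\<^sup>2 / 4 * (LINT \<eta>:{\<xi>..1}|lborel. Mbf b f \<eta> * (\<eta> - \<xi>)))}"

end

theory Submission
  imports Defs
begin

text \<open>
  Along a minimizing sequence $(b_n, f_n)$ the even Chebyshev coefficients are bounded, and
  $a_0(f_n) b_n = 4/\pi$ keeps $b_n$ away from $0$, so a subsequence converges in $b$ and in every
  coefficient. Finiteness of the drag makes the blocks $4^j - 1 \le m < 4^{j+1} - 1$ of the limit
  Chebyshev series geometrically small in $L^1$, so the series converges almost everywhere to a limit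
  wing, whose square norm is controlled by Fatou. The bending moment tests $f$ against a continuous
  kernel, hence by Weierstrass approximation it depends on the coefficients only and converges
  pointwise; dominated convergence carries all constraints to the limit, and the drag is lower
  semicontinuous as a supremum of partial sums.
\<close>

section \<open>Chebyshev polynomials as an orthogonal family\<close>

text \<open>The limit wing has to be an actual function in \<open>H\<close>, not just a sequence of
  coefficients. Square summability alone gives little control over pointwise convergence; the drag
  weight does. On block j the weight \<open>2m + 1\<close> is at least \<open>4^j\<close>, so by
  orthogonality the block has L2 norm of order \<open>2^-j\<close> and, \<open>mu\<close> being
  finite, L1 norm of the same order. These norms sum, so the block partial sums converge almost
  everywhere by Tonelli. A given wing f is not identified with its own series. The two share all
  Chebyshev integrals, and the moment sees a wing only through integrals against continuous kernels,
  where they agree. Passing to the series also supplies the L1 bound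
  \<open>pi / 4 * (1 + C)\<close>, which depends on the drag bound only and controls both the
  polynomial approximation error and the change of kernel when the span varies.\<close>

definition mu :: "real measure" where
  "mu = density (restrict_space lborel {-1<..<1}) (\<lambda>x. ennreal (sqrt (1 - x\<^sup>2)))"

lemma space_mu [simp]: "space mu = {-1<..<1}"
  by (simp add: mu_def space_restrict_space)

lemma measurable_mu_iff: "f \<in> borel_measurable mu \<longleftrightarrow> f \<in> borel_measurable (restrict_space lborel {-1<..<1})"
  by (simp add: mu_def)

lemma borel_measurable_mu: "f \<in> borel_measurable borel \<Longrightarrow> f \<in> borel_measurable mu"
  unfolding measurable_mu_iff by (rule measurable_restrict_space1) simp

lemma weight_nonneg: "-1 < x \<Longrightarrow> x < 1 \<Longrightarrow> 0 \<le> sqrt (1 - x\<^sup>2)" for x :: real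
  by (simp add: abs_square_le_1)

lemma weight_measurable: "(\<lambda>x::real. sqrt (1 - x\<^sup>2)) \<in> borel_measurable (restrict_space lborel {-1<..<1})"
  by (rule measurable_restrict_space1) measurable

lemma integrable_mu_iff:
  fixes f :: "real \<Rightarrow> real"
  assumes "f \<in> borel_measurable mu"
  shows "integrable mu f \<longleftrightarrow> integrable (restrict_space lborel {-1<..<1}) (\<lambda>x. f x * sqrt (1 - x\<^sup>2))"
  unfolding mu_def
  by (subst integrable_density)
     (use assms weight_measurable weight_nonneg in \<open>auto simp: measurable_mu_iff mult.commute intro!: AE_I2\<close>)

lemma integral_mu:
  fixes f :: "real \<Rightarrow> real"
  assumes "f \<in> borel_measurable mu"
  shows "integral\<^sup>L mu f = (LINT x:{-1<..<1}|lborel. f x * sqrt (1 - x\<^sup>2))"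
  unfolding mu_def set_lebesgue_integral_def
  by (subst integral_density, use assms weight_measurable weight_nonneg in
     \<open>auto simp: measurable_mu_iff mult.commute integral_restrict_space intro!: AE_I2\<close>)

lemma isCont_chebU: "isCont (\<lambda>x. chebU n x) x"
  by (induction n rule: induct_nat_012) (auto intro!: continuous_intros)

lemma chebU_measurable [measurable]: "chebU n \<in> borel_measurable borel"
  by (intro borel_measurable_continuous_onI continuous_at_imp_continuous_on ballI isCont_chebU)

lemma chebU_minus: "chebU n (- x) = (-1) ^ n * chebU n x"
  by (induction n x rule: chebU.induct) (auto simp: algebra_simps)

text \<open>Crude growth from the recurrence, \<open>2 * 3 + 1 \<le> 9\<close>. It serves as the
  dominating constant when a fixed \<open>chebU\<close> is used as a bounded kernel.\<close>

lemma chebU_bound: "\<bar>x\<bar> \<le> 1 \<Longrightarrow> \<bar>chebU n x\<bar> \<le> 3 ^ n"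
proof (induction n x rule: chebU.induct)
  case (3 n x)
  have "\<bar>x * chebU (Suc n) x\<bar> \<le> 1 * 3 ^ Suc n"
    unfolding abs_mult using 3 by (intro mult_mono) auto
  with 3 show ?case by auto
qed auto

text \<open>The recurrence is the addition formula for the sine. Keeping \<open>sin t\<close> as a
  factor instead of dividing by it covers its zeros too.\<close>

lemma chebU_cos: "chebU n (cos t) * sin t = sin (real (Suc n) * t)"
proof (induction n "cos t" rule: chebU.induct)
  case 2
  show ?case by (simp add: sin_double)
next
  case (3 n)
  have "chebU (Suc (Suc n)) (cos t) * sin t = 2 * cos t * (chebU (Suc n) (cos t) * sin t) - chebU n (cos t) * sin t"
    by (simp add: algebra_simps)
  also have "\<dots> = 2 * cos t * sin (real (Suc (Suc n)) * t) - sin (real (Suc n) * t)"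
    using 3 by simp
  also have "real (Suc n) * t = real (Suc (Suc n)) * t - t" by (simp add: algebra_simps)
  also have "2 * cos t * sin (real (Suc (Suc n)) * t) - sin (real (Suc (Suc n)) * t - t)
      = sin (real (Suc (Suc n)) * t + t)"
    by (simp only: sin_add sin_diff) (simp add: algebra_simps)
  also have "real (Suc (Suc n)) * t + t = real (Suc (Suc (Suc n))) * t" by (simp add: algebra_simps)
  finally show ?case .
qed auto

lemma chebU_arccos:
  assumes "-1 \<le> x" "x \<le> 1"
  shows "chebU n x * sqrt (1 - x\<^sup>2) = sin (real (Suc n) * arccos x)"
  using chebU_cos[of n "arccos x"] assms by (simp add: sin_arccos)

text \<open>Under x = cos t the integrand becomes a product of two sines, and \<open>G\<close> is its antiderivative.\<close>
lemma chebU_integral_arccos: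
  assumes G: "\<And>t. (G has_real_derivative sin (real (Suc n) * t) * sin (real (Suc m) * t)) (at t)"
  shows "(LINT x:{-1<..<1}|lborel. chebU n x * chebU m x * sqrt (1 - x\<^sup>2)) = G pi - G 0"
proof -
  let ?f = "\<lambda>x. chebU n x * chebU m x * sqrt (1 - x\<^sup>2)"
  have contf: "continuous_on {-1..1} ?f"
    by (intro continuous_intros continuous_at_imp_continuous_on ballI isCont_chebU)
  have contG: "continuous_on UNIV G"
    by (rule DERIV_continuous_on[OF has_field_derivative_at_within[OF G]])
  \<comment> \<open>The substitution reverses orientation, hence the primitive
    \<open>- G (arccos x)\<close>. It is continuous on the closed interval, but
    \<open>arccos\<close> is not differentiable at the endpoints, so the interior form of the
    fundamental theorem is applied.\<close>
  have "(?f has_integral (- G (arccos 1) - - G (arccos (-1)))) {-1..1}"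
  proof (rule fundamental_theorem_of_calculus_interior[where f = "\<lambda>x. - G (arccos x)"])
    show "continuous_on {-1..1} (\<lambda>x. - G (arccos x))"
      by (intro continuous_intros continuous_on_compose2[OF contG]) auto
  next
    fix x :: real assume x: "x \<in> {-1<..<1}"
    then have s: "sqrt (1 - x\<^sup>2) > 0" by (simp add: abs_square_less_1 abs_less_iff)
    have e: "sin (real (Suc k) * arccos x) = chebU k x * sqrt (1 - x\<^sup>2)" for k
      using chebU_arccos[of x k] x by simp
    have "((\<lambda>x. - G (arccos x)) has_real_derivative
      - (sin (real (Suc n) * arccos x) * sin (real (Suc m) * arccos x) * inverse (- sqrt (1 - x\<^sup>2)))) (at x)"
      using x by (intro DERIV_minus DERIV_chain2[OF G] DERIV_arccos) auto
    also have "- (sin (real (Suc n) * arccos x) * sin (real (Suc m) * arccos x) * inverse (- sqrt (1 - x\<^sup>2))) = ?f x"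
      unfolding e using s by (simp add: field_simps)
    finally show "((\<lambda>x. - G (arccos x)) has_vector_derivative ?f x) (at x)"
      by (simp add: has_real_derivative_iff_has_vector_derivative)
  qed simp
  then have "integral {-1..1} ?f = G pi - G 0"
    by (simp add: integral_unique)
  then have "integral {-1<..<1} ?f = G pi - G 0"
    by (simp add: integral_open_interval_real)
  moreover have "set_integrable lborel {-1<..<1} ?f"
    by (rule set_integrable_subset[OF borel_integrable_compact[OF _ contf, unfolded set_integrable_def[symmetric]]])
       auto
  ultimately show ?thesis
    using set_borel_integral_eq_integral(2) by metis
qed

lemma chebU_measurable_mu [measurable]: "chebU n \<in> borel_measurable mu"
  by (intro borel_measurable_mu) measurable

lemma chebU_orthogonal:
  "(\<integral>x. chebU n x * chebU m x \<partial>mu) = (if n = m then pi / 2 else 0)"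
proof -
  \<comment> \<open>Difference and sum of the frequencies \<open>n + 1\<close> and
    \<open>m + 1\<close>; both are integers, so the sines in the primitives vanish at
    \<open>pi\<close>.\<close>
  define d s where "d = real n - real m" and "s = real n + real m + 2"
  have s: "s > 0" by (simp add: s_def)
  have prod: "sin (real (Suc n) * t) * sin (real (Suc m) * t) = (cos (d * t) - cos (s * t)) / 2" for t
    unfolding sin_times_sin d_def s_def by (simp add: algebra_simps)
  have int: "integral\<^sup>L mu (\<lambda>x. chebU n x * chebU m x) = (LINT x:{-1<..<1}|lborel. chebU n x * chebU m x * sqrt (1 - x\<^sup>2))"
    by (intro integral_mu) measurable
  have sinz: "sin (s * pi) = 0" "sin (d * pi) = 0"
  proof -
    have "s = of_int (int n + int m + 2)" "d = of_int (int n - int m)" by (simp_all add: s_def d_def)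
    then show "sin (s * pi) = 0" "sin (d * pi) = 0"
      by (metis sin_zero_iff_int2)+
  qed
  show ?thesis
  proof (cases "n = m")
    \<comment> \<open>Here \<open>d = 0\<close>, so \<open>cos (d * t)\<close> is 1 with primitive
      \<open>t\<close>; half its value at \<open>pi\<close> is the norm
      \<open>pi / 2\<close>.\<close>
    case True
    have "integral\<^sup>L mu (\<lambda>x. chebU n x * chebU m x) = (\<lambda>t. (t - sin (s * t) / s) / 2) pi - (\<lambda>t. (t - sin (s * t) / s) / 2) 0"
      unfolding int using s True
      by (intro chebU_integral_arccos) (unfold prod, auto intro!: derivative_eq_intros simp: d_def)
    with True sinz show ?thesis by simp
  next
    case False
    then have d: "d \<noteq> 0" by (simp add: d_def)
    have "integral\<^sup>L mu (\<lambda>x. chebU n x * chebU m x) = (\<lambda>t. (sin (d * t) / d - sin (s * t) / s) / 2) pi - (\<lambda>t. (sin (d * t) / d - sin (s * t) / s) / 2) 0"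
      unfolding int using s d
      by (intro chebU_integral_arccos) (unfold prod, auto intro!: derivative_eq_intros)
    with False sinz show ?thesis by simp
  qed
qed

section \<open>Finiteness of the weighted measure and integration against bounded kernels\<close>

lemma finite_measure_mu: "finite_measure mu"
proof
  have "emeasure mu (space mu) = (\<integral>\<^sup>+x. ennreal (sqrt (1 - x\<^sup>2)) * indicator {-1<..<1} x \<partial>restrict_space lborel {-1<..<1})"
    unfolding mu_def by (subst emeasure_density) (auto simp: space_restrict_space sets_restrict_space intro: measurable_compose[OF weight_measurable])
  also have "\<dots> \<le> (\<integral>\<^sup>+x. 1 \<partial>restrict_space lborel {-1<..<1::real})"
    by (intro nn_integral_mono) (auto simp: indicator_def)
  also have "\<dots> = ennreal 2"
    by (simp add: space_restrict_space emeasure_restrict_space)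
  finally show "emeasure mu (space mu) \<noteq> \<infinity>"
    by (auto simp: top_unique)
qed

lemma measure_mu: "measure mu {-1<..<1} = pi / 2"
proof -
  have "measure mu {-1<..<1} = (\<integral>x. chebU 0 x * chebU 0 x \<partial>mu)"
    by simp
  then show ?thesis
    by (simp only: chebU_orthogonal) simp
qed

lemma integral_mu_const: "(\<integral>x. (c::real) \<partial>mu) = c * (pi / 2)" "integrable mu (\<lambda>x. c :: real)"
  using finite_measure_mu measure_mu by (auto simp: finite_measure.emeasure_finite finite_measure.integrable_const)

text \<open>The basic perturbation estimate: changing a kernel by at most D changes the integral by
  at most D times the L1 norm of the density.\<close>

lemma integrable_mult_bounded:
  fixes K :: "real \<Rightarrow> real"
  assumes "integrable mu h" "K \<in> borel_measurable mu" "\<And>x. -1 < x \<Longrightarrow> x < 1 \<Longrightarrow> \<bar>K x\<bar> \<le> D"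
  shows "integrable mu (\<lambda>x. h x * K x)" "\<bar>\<integral>x. h x * K x \<partial>mu\<bar> \<le> D * (\<integral>x. \<bar>h x\<bar> \<partial>mu)"
proof -
  have le: "\<bar>h x * K x\<bar> \<le> D * \<bar>h x\<bar>" if "-1 < x" "x < 1" for x
    using mult_right_mono[OF assms(3)[OF that], of "\<bar>h x\<bar>"] by (simp add: abs_mult mult.commute)
  show int: "integrable mu (\<lambda>x. h x * K x)"
    by (rule Bochner_Integration.integrable_bound[of _ "\<lambda>x. D * \<bar>h x\<bar>"])
       (use assms le in \<open>auto intro!: AE_I2 order_trans[OF le abs_ge_self]\<close>)
  have "\<bar>\<integral>x. h x * K x \<partial>mu\<bar> \<le> (\<integral>x. \<bar>h x * K x\<bar> \<partial>mu)"
    by (rule integral_abs_bound)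
  also have "\<dots> \<le> (\<integral>x. D * \<bar>h x\<bar> \<partial>mu)"
    by (rule integral_mono) (use int assms le in auto)
  finally show "\<bar>\<integral>x. h x * K x \<partial>mu\<bar> \<le> D * (\<integral>x. \<bar>h x\<bar> \<partial>mu)" by simp
qed

lemma continuous_mu:
  fixes K :: "real \<Rightarrow> real"
  assumes "continuous_on {-1..1} K"
  shows "K \<in> borel_measurable mu" "\<exists>D. \<forall>x\<in>{-1..1}. \<bar>K x\<bar> \<le> D"
proof -
  have "K \<in> borel_measurable (restrict_space borel {-1<..<1})"
    by (rule borel_measurable_continuous_on_restrict) (rule continuous_on_subset[OF assms], auto)
  then show "K \<in> borel_measurable mu"
    unfolding measurable_mu_iff
    by (subst measurable_cong_sets[of _ "restrict_space borel {-1<..<1}" borel borel]) (auto simp: sets_restrict_space)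
  have "bounded (K ` {-1..1})"
    by (rule compact_imp_bounded[OF compact_continuous_image[OF assms]]) simp
  then show "\<exists>D. \<forall>x\<in>{-1..1}. \<bar>K x\<bar> \<le> D"
    by (auto simp: bounded_iff)
qed

lemma integrable_mult_continuous:
  fixes K :: "real \<Rightarrow> real"
  assumes "integrable mu h" "continuous_on {-1..1} K"
  shows "integrable mu (\<lambda>x. h x * K x)"
proof -
  obtain D where "\<forall>x\<in>{-1..1}. \<bar>K x\<bar> \<le> D"
    using continuous_mu(2)[OF assms(2)] by blast
  then show ?thesis
    by (intro integrable_mult_bounded(1)[of _ _ D] assms continuous_mu(1)) auto
qed

lemma continuous_on_chebU: "continuous_on S (\<lambda>x. chebU n x)"
  by (intro continuous_at_imp_continuous_on ballI isCont_chebU)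

section \<open>Weak convergence tested on Chebyshev polynomials\<close>

text \<open>Multiplication by \<open>x\<close> shifts the index: \<open>2 x U\<^sub>k = U\<^sub>k\<^sub>+\<^sub>1 + U\<^sub>k\<^sub>-\<^sub>1\<close>.\<close>
lemma moments_tendsto:
  assumes int: "\<And>n. integrable mu (h n)" "integrable mu h0"
    and mom: "\<And>k. (\<lambda>n. \<integral>x. h n x * chebU k x \<partial>mu) \<longlonglongrightarrow> (\<integral>x. h0 x * chebU k x \<partial>mu)"
  shows "(\<lambda>n. \<integral>x. h n x * (x ^ j * chebU k x) \<partial>mu) \<longlonglongrightarrow> (\<integral>x. h0 x * (x ^ j * chebU k x) \<partial>mu)"
proof (induction j arbitrary: k)
  case 0
  show ?case using mom by simp
next
  case (Suc j)
  have i: "integrable mu (\<lambda>x. h x * (x ^ j * chebU i x))" if "integrable mu h" for h i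
    using that by (intro integrable_mult_continuous continuous_intros continuous_on_chebU)
  show ?case
  proof (cases k)
    case 0
    \<comment> \<open>The shift formula with \<open>U_(-1) = 0\<close>: only the upper neighbour
      remains.\<close>
    have e: "h x * (x ^ Suc j * chebU k x) = h x * (x ^ j * chebU 1 x) / 2" for h :: "real \<Rightarrow> real" and x
      by (simp add: 0)
    show ?thesis unfolding e integral_divide_zero by (intro tendsto_intros Suc.IH) simp
  next
    case (Suc i)
    have e: "h x * (x ^ Suc j * chebU k x)
        = (h x * (x ^ j * chebU (Suc (Suc i)) x) + h x * (x ^ j * chebU i x)) / 2" for h :: "real \<Rightarrow> real" and x
      by (simp add: Suc field_simps)
    have m: "(\<integral>x. h x * (x ^ Suc j * chebU k x) \<partial>mu)
        = ((\<integral>x. h x * (x ^ j * chebU (Suc (Suc i)) x) \<partial>mu) + (\<integral>x. h x * (x ^ j * chebU i x) \<partial>mu)) / 2"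
      if "integrable mu h" for h
      unfolding e using i[OF that, of "Suc (Suc i)"] i[OF that, of i] by simp
    show ?thesis
      unfolding m[OF int(1)] m[OF int(2)] by (intro tendsto_intros Suc.IH) simp
  qed
qed

text \<open>Polynomials are handled by \<open>moments_tendsto\<close>. Replacing K by a uniformly
  close polynomial costs its sup distance times the L1 norm, and the common bound C makes this cost
  uniform in n.\<close>

lemma weak_convergence:
  assumes int: "\<And>n. integrable mu (h n)" "integrable mu h0"
    and bd: "\<And>n. (\<integral>x. \<bar>h n x\<bar> \<partial>mu) \<le> C"
    and mom: "\<And>k. (\<lambda>n. \<integral>x. h n x * chebU k x \<partial>mu) \<longlonglongrightarrow> (\<integral>x. h0 x * chebU k x \<partial>mu)"
    and K: "continuous_on {-1..1} K"
  shows "(\<lambda>n. \<integral>x. h n x * K x \<partial>mu) \<longlonglongrightarrow> (\<integral>x. h0 x * K x \<partial>mu)"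
proof (rule tendstoI)
  fix e :: real assume e: "e > 0"
  \<comment> \<open>\<open>E\<close> strictly exceeds the two L1 norms together, so accuracy
    \<open>e / (2 * E)\<close> keeps both replacements below \<open>e / 2\<close> in total; the
    other half of e goes to the polynomial integrals.\<close>
  define E where "E = C + (\<integral>x. \<bar>h0 x\<bar> \<partial>mu) + 1"
  have "0 \<le> (\<integral>x. \<bar>h 0 x\<bar> \<partial>mu)" "0 \<le> (\<integral>x. \<bar>h0 x\<bar> \<partial>mu)" by simp_all
  then have E: "E > 0" using bd[of 0] unfolding E_def by linarith
  define d where "d = e / (2 * E)"
  have d: "d > 0" using e E by (simp add: d_def)
  obtain p where p: "real_polynomial_function p" "\<And>x. x \<in> {-1..1} \<Longrightarrow> \<bar>K x - p x\<bar> < d"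
    using Stone_Weierstrass_real_polynomial_function[OF _ K d] by auto
  obtain a N where pN: "p = (\<lambda>x. \<Sum>i\<le>N. a i * x ^ i)"
    using p(1) real_polynomial_function_iff_sum by blast
  have contp: "continuous_on {-1..1} p" unfolding pN by (intro continuous_intros)
  \<comment> \<open>The factor \<open>chebU 0\<close>, which is 1, brings monomials into the form
    treated by \<open>moments_tendsto\<close>.\<close>
  have ip: "(\<integral>x. f x * p x \<partial>mu) = (\<Sum>i\<le>N. a i * (\<integral>x. f x * (x ^ i * chebU 0 x) \<partial>mu))" if "integrable mu f" for f
  proof -
    have i: "integrable mu (\<lambda>x. f x * (x ^ i * chebU 0 x))" for i
      using that by (intro integrable_mult_continuous continuous_intros continuous_on_chebU)
    have "(\<integral>x. f x * p x \<partial>mu) = (\<integral>x. (\<Sum>i\<le>N. a i * (f x * (x ^ i * chebU 0 x))) \<partial>mu)"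
      by (simp add: pN sum_distrib_left mult.left_commute)
    also have "\<dots> = (\<Sum>i\<le>N. \<integral>x. a i * (f x * (x ^ i * chebU 0 x)) \<partial>mu)"
      by (rule Bochner_Integration.integral_sum) (rule integrable_mult_right[OF i])
    also have "\<dots> = (\<Sum>i\<le>N. a i * (\<integral>x. f x * (x ^ i * chebU 0 x) \<partial>mu))"
      by (simp only: integral_mult_right_zero)
    finally show ?thesis .
  qed
  have "(\<lambda>n. \<integral>x. h n x * p x \<partial>mu) \<longlonglongrightarrow> (\<integral>x. h0 x * p x \<partial>mu)"
    unfolding ip[OF int(1)] ip[OF int(2)] by (intro tendsto_intros moments_tendsto int mom)
  then have ev: "\<forall>\<^sub>F n in sequentially. dist (\<integral>x. h n x * p x \<partial>mu) (\<integral>x. h0 x * p x \<partial>mu) < e / 2"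
    using e by (intro tendstoD) auto
  have diff: "\<bar>(\<integral>x. f x * K x \<partial>mu) - (\<integral>x. f x * p x \<partial>mu)\<bar> \<le> d * (\<integral>x. \<bar>f x\<bar> \<partial>mu)" if f: "integrable mu f" for f
  proof -
    have "(\<integral>x. f x * K x \<partial>mu) - (\<integral>x. f x * p x \<partial>mu) = (\<integral>x. f x * (K x - p x) \<partial>mu)"
      unfolding right_diff_distrib
      by (rule Bochner_Integration.integral_diff[symmetric]; intro integrable_mult_continuous f K contp)
    moreover have "\<bar>\<integral>x. f x * (K x - p x) \<partial>mu\<bar> \<le> d * (\<integral>x. \<bar>f x\<bar> \<partial>mu)"
      by (rule integrable_mult_bounded(2)[OF f continuous_mu(1)[OF continuous_on_diff[OF K contp]]])
         (use p(2) in \<open>auto intro: less_imp_le\<close>)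
    ultimately show ?thesis by simp
  qed
  show "\<forall>\<^sub>F n in sequentially. dist (\<integral>x. h n x * K x \<partial>mu) (\<integral>x. h0 x * K x \<partial>mu) < e"
    using ev
  proof eventually_elim
    case (elim n)
    have "d * (\<integral>x. \<bar>h n x\<bar> \<partial>mu) + d * (\<integral>x. \<bar>h0 x\<bar> \<partial>mu) < d * E"
      using d bd[of n] by (simp add: E_def flip: distrib_left)
    also have "d * E = e / 2" using E by (simp add: d_def)
    finally show ?case
      using elim diff[OF int(1)[of n]] diff[OF int(2)] unfolding dist_real_def by linarith
  qed
qed

section \<open>Members of H and their Chebyshev coefficients\<close>

lemma H_D:
  assumes "f \<in> H"
  shows "f \<in> borel_measurable mu" "integrable mu (\<lambda>x. (f x)\<^sup>2)" "integrable mu f"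
    "\<And>x. -1 < x \<Longrightarrow> x < 1 \<Longrightarrow> f (- x) = f x"
proof -
  show m: "f \<in> borel_measurable mu"
    using assms by (simp add: H_def measurable_mu_iff)
  then have "(\<lambda>x. (f x)\<^sup>2) \<in> borel_measurable mu" by measurable
  then show i: "integrable mu (\<lambda>x. (f x)\<^sup>2)"
    using assms by (simp add: H_def integrable_mu_iff)
  have "\<bar>y\<bar> \<le> 1 + y\<^sup>2" for y :: real
    using zero_le_power2[of "\<bar>y\<bar> - 1"] zero_le_power2[of y] unfolding power2_diff by simp
  then have "AE x in mu. norm (f x) \<le> norm (1 + (f x)\<^sup>2)"
    by (intro AE_I2) (auto intro: order_trans[OF _ abs_ge_self])
  then show "integrable mu f"
    by (rule Bochner_Integration.integrable_bound[OF Bochner_Integration.integrable_add[OF integral_mu_const(2) i] m])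
  show "\<And>x. -1 < x \<Longrightarrow> x < 1 \<Longrightarrow> f (- x) = f x"
    using assms by (auto simp: H_def)
qed

lemma H_I:
  assumes "f \<in> borel_measurable mu" "integrable mu (\<lambda>x. (f x)\<^sup>2)"
    "\<And>x. -1 < x \<Longrightarrow> x < 1 \<Longrightarrow> f (- x) = f x"
  shows "f \<in> H"
  using assms integrable_mu_iff[of "\<lambda>x. (f x)\<^sup>2"] by (auto simp: H_def measurable_mu_iff)

lemma coef_mu:
  assumes "f \<in> borel_measurable mu"
  shows "coef n f = 2 / pi * (\<integral>x. f x * chebU n x \<partial>mu)"
  unfolding coef_def using assms by (subst integral_mu) auto

text \<open>Reflection turns the integrand into its negative. The drag controls even coefficients
  only, whereas weak convergence tests every \<open>chebU k\<close>; evenness of the wing settles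
  the odd ones.\<close>

lemma coef_odd:
  assumes "f \<in> H" "odd n"
  shows "coef n f = 0"
proof -
  let ?F = "\<lambda>x. indicator {-1<..<1} x *\<^sub>R (f x * chebU n x * sqrt (1 - x\<^sup>2))"
  have "integral\<^sup>L lborel ?F = (\<integral>x. ?F (0 + (-1) * x) \<partial>lborel)"
    using lborel_integral_real_affine[of "-1" ?F 0] by simp
  also have "(\<lambda>x. ?F (0 + (-1) * x)) = (\<lambda>x. - ?F x)"
    using H_D(4)[OF assms(1)] assms(2) by (auto simp: fun_eq_iff indicator_def chebU_minus)
  finally show ?thesis
    by (simp add: coef_def set_lebesgue_integral_def)
qed

lemma integrable_mu_continuous:
  fixes K :: "real \<Rightarrow> real"
  assumes "continuous_on {-1..1} K"
  shows "integrable mu K"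
  using integrable_mult_continuous[OF integral_mu_const(2)[of 1] assms] by simp

lemma integral_square_cheb_sum:
  assumes "finite A"
  shows "(\<integral>x. (\<Sum>m\<in>A. \<alpha> m * chebU (2 * m) x)\<^sup>2 \<partial>mu) = pi / 2 * (\<Sum>m\<in>A. (\<alpha> m)\<^sup>2)"
proof -
  have i: "integrable mu (\<lambda>x. \<alpha> m * \<alpha> l * (chebU (2 * m) x * chebU (2 * l) x))" for m l
    by (intro integrable_mu_continuous continuous_intros continuous_on_chebU)
  have "(\<integral>x. (\<Sum>m\<in>A. \<alpha> m * chebU (2 * m) x)\<^sup>2 \<partial>mu)
      = (\<integral>x. (\<Sum>m\<in>A. \<Sum>l\<in>A. \<alpha> m * \<alpha> l * (chebU (2 * m) x * chebU (2 * l) x)) \<partial>mu)"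
    unfolding power2_eq_square sum_product by (simp only: mult_ac)
  also have "\<dots> = (\<Sum>m\<in>A. \<Sum>l\<in>A. \<integral>x. \<alpha> m * \<alpha> l * (chebU (2 * m) x * chebU (2 * l) x) \<partial>mu)"
    by (subst Bochner_Integration.integral_sum, rule Bochner_Integration.integrable_sum, rule i,
        rule sum.cong[OF refl], rule Bochner_Integration.integral_sum, rule i)
  also have "\<dots> = (\<Sum>m\<in>A. \<Sum>l\<in>A. if m = l then pi / 2 * (\<alpha> m)\<^sup>2 else 0)"
    unfolding integral_mult_right_zero chebU_orthogonal
    by (intro sum.cong refl) (simp add: power2_eq_square)
  also have "\<dots> = pi / 2 * (\<Sum>m\<in>A. (\<alpha> m)\<^sup>2)"
    using assms by (simp add: sum_distrib_left)
  finally show ?thesis .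
qed

section \<open>Reconstructing a wing from its coefficients\<close>

text \<open>The shift by 1 puts \<open>m = 0\<close> into block 0, so the blocks partition the
  naturals, while \<open>m + 1 \<ge> 4 ^ j\<close> still holds on block j.\<close>

definition cheb_block :: "(nat \<Rightarrow> real) \<Rightarrow> nat \<Rightarrow> real \<Rightarrow> real" where
  "cheb_block \<alpha> j x = (\<Sum>m\<in>{4 ^ j - 1..<4 ^ Suc j - 1}. \<alpha> m * chebU (2 * m) x)"

text \<open>Summing by blocks takes the limit along partial sums of length \<open>4 ^ J - 1\<close>
  only. Under a drag bound the points of divergence form a null set; evenness holds even there,
  since each block is itself even.\<close>

definition cheb_series :: "(nat \<Rightarrow> real) \<Rightarrow> real \<Rightarrow> real" where
  "cheb_series \<alpha> x = (\<Sum>j. cheb_block \<alpha> j x)"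

lemma sum_cheb_block: "(\<Sum>j<J. cheb_block \<alpha> j x) = (\<Sum>m<4 ^ J - 1. \<alpha> m * chebU (2 * m) x)"
proof (induction J)
  case (Suc J)
  have "(4::nat) ^ J - 1 \<le> 4 ^ Suc J - 1" by (intro diff_le_mono power_increasing) auto
  with Suc show ?case
    using sum.atLeastLessThan_concat[of 0 "4 ^ J - 1" "4 ^ Suc J - 1" "\<lambda>m. \<alpha> m * chebU (2 * m) x"]
    by (simp add: cheb_block_def atLeast0LessThan)
qed simp

lemma continuous_cheb_block: "continuous_on S (cheb_block \<alpha> j)"
  unfolding cheb_block_def [abs_def] by (intro continuous_intros continuous_on_chebU)

lemma cheb_block_measurable [measurable]: "cheb_block \<alpha> j \<in> borel_measurable mu"
  by (rule continuous_mu(1)[OF continuous_cheb_block])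

lemma cheb_series_measurable [measurable]: "cheb_series \<alpha> \<in> borel_measurable mu"
  unfolding cheb_series_def [abs_def] by measurable

lemma cheb_series_minus: "cheb_series \<alpha> (- x) = cheb_series \<alpha> x"
  by (simp add: cheb_series_def cheb_block_def chebU_minus)

text \<open>A drag bound in the form of partial sums, with \<open>C\<close> equal to
  \<open>8 / pi\<close> times the bound on the drag (\<open>drag_le_iff\<close>). It is imposed on a
  bare sequence, so that it also applies to limits of coefficients not yet known to belong to a
  wing.\<close>

context
  fixes \<alpha> :: "nat \<Rightarrow> real" and C :: real
  assumes bound: "\<And>N. (\<Sum>m<N. (2 * real m + 1) * (\<alpha> m)\<^sup>2) \<le> C"
begin

lemma cheb_C_nonneg: "0 \<le> C"
  using bound[of 0] by simp

lemma sum_squares_le: "(\<Sum>m<N. (\<alpha> m)\<^sup>2) \<le> C"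
proof -
  have "(\<Sum>m<N. (\<alpha> m)\<^sup>2) \<le> (\<Sum>m<N. (2 * real m + 1) * (\<alpha> m)\<^sup>2)"
    by (intro sum_mono) (simp add: mult_le_cancel_right1 algebra_simps)
  then show ?thesis using bound[of N] by simp
qed

text \<open>Every weight on the block is at least \<open>4 ^ j\<close>, so the weighted bound gains
  this factor over mere square summability.\<close>

lemma sum_block_squares_le: "(\<Sum>m\<in>{4 ^ j - 1..<4 ^ Suc j - 1}. (\<alpha> m)\<^sup>2) \<le> C / 4 ^ j"
proof -
  have "4 ^ j * (\<Sum>m\<in>{4 ^ j - 1..<4 ^ Suc j - 1}. (\<alpha> m)\<^sup>2)
      \<le> (\<Sum>m\<in>{4 ^ j - 1..<4 ^ Suc j - 1}. (2 * real m + 1) * (\<alpha> m)\<^sup>2)"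
    unfolding sum_distrib_left
  proof (intro sum_mono mult_right_mono)
    fix m assume "m \<in> {4 ^ j - 1..<4 ^ Suc j - (1::nat)}"
    then have "4 ^ j \<le> m + 1" by auto
    then have "real (4 ^ j) \<le> real (m + 1)" by (rule of_nat_mono)
    then show "4 ^ j \<le> 2 * real m + 1" by simp
  qed simp
  also have "\<dots> \<le> (\<Sum>m<4 ^ Suc j - 1. (2 * real m + 1) * (\<alpha> m)\<^sup>2)"
    by (intro sum_mono2) auto
  also have "\<dots> \<le> C" by (rule bound)
  finally show ?thesis by (simp add: field_simps)
qed

lemma integral_abs_block_le: "(\<integral>x. \<bar>cheb_block \<alpha> j x\<bar> \<partial>mu) \<le> pi / 4 * (1 + C) * (1 / 2) ^ j"
proof -
  \<comment> \<open>\<open>\<bar>B\<bar> \<le> t / 2 + B\<^sup>2 / (2 t)\<close>, with \<open>t\<close> the order of the \<open>L\<^sup>2\<close> norm of the block.\<close>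
  define t :: real where "t = (1 / 2) ^ j"
  have t: "t > 0" "(4::real) ^ j * t\<^sup>2 = 1"
    by (simp_all add: t_def power_mult_distrib[symmetric] power_even_eq[symmetric] mult.commute[of _ 2])
       (simp add: power_divide power_mult)
  let ?B = "\<lambda>x. cheb_block \<alpha> j x"
  have c: "continuous_on {-1..1} (\<lambda>x. (?B x)\<^sup>2)" "continuous_on {-1..1} (\<lambda>x. \<bar>?B x\<bar>)"
    by (intro continuous_intros continuous_cheb_block)+
  have i: "integrable mu (\<lambda>x. t / 2 + 1 / (2 * t) * (?B x)\<^sup>2)"
    by (intro integrable_mu_continuous continuous_intros continuous_cheb_block)
  have "(\<integral>x. \<bar>?B x\<bar> \<partial>mu) \<le> (\<integral>x. t / 2 + 1 / (2 * t) * (?B x)\<^sup>2 \<partial>mu)"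
  proof (rule integral_mono[OF integrable_mu_continuous[OF c(2)] i])
    fix x
    have "0 \<le> (\<bar>?B x\<bar> - t)\<^sup>2" by simp
    then show "\<bar>?B x\<bar> \<le> t / 2 + 1 / (2 * t) * (?B x)\<^sup>2"
      unfolding power2_diff using t by (simp add: field_simps power2_eq_square)
  qed
  also have "\<dots> = t / 2 * (pi / 2) + 1 / (2 * t) * (\<integral>x. (?B x)\<^sup>2 \<partial>mu)"
    using integral_mu_const[of "t / 2"] integrable_mu_continuous[OF c(1)] by simp
  also have "(\<integral>x. (?B x)\<^sup>2 \<partial>mu) = pi / 2 * (\<Sum>m\<in>{4 ^ j - 1..<4 ^ Suc j - 1}. (\<alpha> m)\<^sup>2)"
    unfolding cheb_block_def by (rule integral_square_cheb_sum) simp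
  also have "t / 2 * (pi / 2) + 1 / (2 * t) * \<dots> \<le> t / 2 * (pi / 2) + 1 / (2 * t) * (pi / 2 * (C / 4 ^ j))"
    using t by (intro add_left_mono mult_left_mono sum_block_squares_le) auto
  also have "C / 4 ^ j = C * t\<^sup>2"
    using t(2) by (simp add: field_simps)
  also have "t / 2 * (pi / 2) + 1 / (2 * t) * (pi / 2 * (C * t\<^sup>2)) = pi / 4 * (1 + C) * t"
    using t(1) by (simp add: field_simps power2_eq_square)
  finally show ?thesis by (simp add: t_def)
qed

lemma integrable_block: "integrable mu (cheb_block \<alpha> j)"
  by (rule integrable_mu_continuous[OF continuous_cheb_block])

text \<open>The L1 norms of the blocks have a geometric majorant. By Tonelli the sum of the absolute
  values has finite integral, hence is finite almost everywhere.\<close>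

lemma AE_summable_block: "AE x in mu. summable (\<lambda>j. \<bar>cheb_block \<alpha> j x\<bar>)"
proof -
  let ?c = "\<lambda>j. pi / 4 * (1 + C) * (1 / 2) ^ j"
  have c: "0 \<le> ?c j" "summable ?c" for j
    using cheb_C_nonneg by (auto intro!: summable_mult summable_geometric)
  have "(\<integral>\<^sup>+x. (\<Sum>j. ennreal \<bar>cheb_block \<alpha> j x\<bar>) \<partial>mu) = (\<Sum>j. \<integral>\<^sup>+x. ennreal \<bar>cheb_block \<alpha> j x\<bar> \<partial>mu)"
    by (rule nn_integral_suminf) measurable
  also have "\<dots> = (\<Sum>j. ennreal (\<integral>x. \<bar>cheb_block \<alpha> j x\<bar> \<partial>mu))"
    using integrable_block by (simp add: nn_integral_eq_integral)
  also have "\<dots> \<le> (\<Sum>j. ennreal (?c j))"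
    by (intro suminf_le ennreal_leI integral_abs_block_le) auto
  also have "\<dots> = ennreal (\<Sum>j. ?c j)"
    by (rule suminf_ennreal_eq) (use c summable_sums in auto)
  finally have "(\<integral>\<^sup>+x. (\<Sum>j. ennreal \<bar>cheb_block \<alpha> j x\<bar>) \<partial>mu) \<noteq> \<infinity>"
    by (auto simp: top_unique)
  then have "AE x in mu. (\<Sum>j. ennreal \<bar>cheb_block \<alpha> j x\<bar>) \<noteq> \<infinity>"
    by (intro nn_integral_PInf_AE) measurable
  then show ?thesis
    by eventually_elim (auto intro: summable_suminf_not_top)
qed

text \<open>A bounded kernel multiplies the geometric majorant by D, which permits termwise
  integration. The kernel 1 yields integrability of the series, and \<open>chebU\<close> yields its
  coefficients.\<close>

lemma cheb_series_sums:
  assumes K: "K \<in> borel_measurable mu" and D: "\<And>x. -1 < x \<Longrightarrow> x < 1 \<Longrightarrow> \<bar>K x\<bar> \<le> D"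
  shows "integrable mu (\<lambda>x. cheb_series \<alpha> x * K x)"
    "(\<lambda>j. \<integral>x. cheb_block \<alpha> j x * K x \<partial>mu) sums (\<integral>x. cheb_series \<alpha> x * K x \<partial>mu)"
proof -
  have D0: "0 \<le> D" using D[of 0] abs_ge_zero[of "K 0"] by linarith
  have i: "integrable mu (\<lambda>x. cheb_block \<alpha> j x * K x)" for j
    by (rule integrable_mult_bounded(1)[OF integrable_block K D])
  have "AE x in mu. \<bar>K x\<bar> \<le> D" using D by (intro AE_I2) auto
  with AE_summable_block have s1: "AE x in mu. summable (\<lambda>j. norm (cheb_block \<alpha> j x * K x))"
    by eventually_elim (auto simp: abs_mult intro!: summable_mult2)
  have "summable (\<lambda>j. D * (pi / 4 * (1 + C) * (1 / 2) ^ j))"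
    by (intro summable_mult summable_geometric) simp
  then have s2: "summable (\<lambda>j. \<integral>x. norm (cheb_block \<alpha> j x * K x) \<partial>mu)"
  proof (rule summable_comparison_test'[where N = 0])
    fix j :: nat
    have "(\<integral>x. norm (cheb_block \<alpha> j x * K x) \<partial>mu) \<le> (\<integral>x. D * \<bar>cheb_block \<alpha> j x\<bar> \<partial>mu)"
    proof (rule integral_mono)
      show "integrable mu (\<lambda>x. norm (cheb_block \<alpha> j x * K x))" using i by (rule integrable_norm)
      show "integrable mu (\<lambda>x. D * \<bar>cheb_block \<alpha> j x\<bar>)" using integrable_block by simp
      fix x assume "x \<in> space mu"
      then show "norm (cheb_block \<alpha> j x * K x) \<le> D * \<bar>cheb_block \<alpha> j x\<bar>"
        using mult_right_mono[OF D[of x], of "\<bar>cheb_block \<alpha> j x\<bar>"] by (simp add: abs_mult mult.commute)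
    qed
    also have "\<dots> \<le> D * (pi / 4 * (1 + C) * (1 / 2) ^ j)"
      using mult_left_mono[OF integral_abs_block_le D0] by simp
    finally show "norm (\<integral>x. norm (cheb_block \<alpha> j x * K x) \<partial>mu) \<le> D * (pi / 4 * (1 + C) * (1 / 2) ^ j)"
      by simp
  qed
  have "AE x in mu. (\<Sum>j. cheb_block \<alpha> j x * K x) = cheb_series \<alpha> x * K x"
    using AE_summable_block
    by eventually_elim (auto simp: cheb_series_def suminf_mult2 dest: summable_rabs_cancel)
  note ae = this
  have m: "(\<lambda>x. \<Sum>j. cheb_block \<alpha> j x * K x) \<in> borel_measurable mu" "(\<lambda>x. cheb_series \<alpha> x * K x) \<in> borel_measurable mu"
    using K by measurable
  have eq: "(\<integral>x. (\<Sum>j. cheb_block \<alpha> j x * K x) \<partial>mu) = (\<integral>x. cheb_series \<alpha> x * K x \<partial>mu)"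
    and eq2: "integrable mu (\<lambda>x. \<Sum>j. cheb_block \<alpha> j x * K x) \<longleftrightarrow> integrable mu (\<lambda>x. cheb_series \<alpha> x * K x)"
    by (rule integral_cong_AE[OF m ae], rule integrable_cong_AE[OF m ae])
  show "integrable mu (\<lambda>x. cheb_series \<alpha> x * K x)"
    using integrable_suminf[OF i s1 s2] eq2 by simp
  show "(\<lambda>j. \<integral>x. cheb_block \<alpha> j x * K x \<partial>mu) sums (\<integral>x. cheb_series \<alpha> x * K x \<partial>mu)"
    using sums_integral[OF i s1 s2] eq by simp
qed

lemma integrable_cheb_series: "integrable mu (cheb_series \<alpha>)"
  using cheb_series_sums(1)[of "\<lambda>_. 1" 1] by simp

text \<open>Fatou turns almost everywhere convergence into a norm bound: each partial sum has square
  integral \<open>pi / 2\<close> times a sum of squared coefficients, at most \<open>C\<close>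
  because the weights \<open>2m + 1\<close> are at least 1.\<close>

lemma cheb_series_square:
  "integrable mu (\<lambda>x. (cheb_series \<alpha> x)\<^sup>2)" "(\<integral>x. (cheb_series \<alpha> x)\<^sup>2 \<partial>mu) \<le> pi / 2 * C"
proof -
  let ?S = "\<lambda>J x. \<Sum>j<J. cheb_block \<alpha> j x"
  have "(\<integral>\<^sup>+x. ennreal ((cheb_series \<alpha> x)\<^sup>2) \<partial>mu) = (\<integral>\<^sup>+x. liminf (\<lambda>J. ennreal ((?S J x)\<^sup>2)) \<partial>mu)"
  proof (rule nn_integral_cong_AE, use AE_summable_block in eventually_elim)
    fix x assume "summable (\<lambda>j. \<bar>cheb_block \<alpha> j x\<bar>)"
    then have "(\<lambda>J. ?S J x) \<longlonglongrightarrow> cheb_series \<alpha> x"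
      unfolding cheb_series_def by (rule summable_LIMSEQ[OF summable_rabs_cancel])
    then have "(\<lambda>J. ennreal ((?S J x)\<^sup>2)) \<longlonglongrightarrow> ennreal ((cheb_series \<alpha> x)\<^sup>2)"
      by (intro tendsto_ennrealI tendsto_intros)
    then show "ennreal ((cheb_series \<alpha> x)\<^sup>2) = liminf (\<lambda>J. ennreal ((?S J x)\<^sup>2))"
      by (intro lim_imp_Liminf[symmetric]) auto
  qed
  also have "\<dots> \<le> liminf (\<lambda>J. \<integral>\<^sup>+x. ennreal ((?S J x)\<^sup>2) \<partial>mu)"
    by (rule nn_integral_liminf) measurable
  also have "\<dots> \<le> liminf (\<lambda>J. ennreal (pi / 2 * C))"
  proof (rule Liminf_mono, rule always_eventually, rule allI)
    fix J
    have c: "continuous_on {-1..1} (\<lambda>x. (\<Sum>m<4 ^ J - 1. \<alpha> m * chebU (2 * m) x)\<^sup>2)"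
      by (intro continuous_intros continuous_on_chebU)
    show "(\<integral>\<^sup>+x. ennreal ((?S J x)\<^sup>2) \<partial>mu) \<le> ennreal (pi / 2 * C)"
      unfolding sum_cheb_block
      by (subst nn_integral_eq_integral[OF integrable_mu_continuous[OF c]])
         (auto simp: integral_square_cheb_sum intro!: ennreal_leI mult_left_mono sum_squares_le)
  qed
  also have "\<dots> = ennreal (pi / 2 * C)" by (simp add: Liminf_const)
  finally have le: "(\<integral>\<^sup>+x. ennreal ((cheb_series \<alpha> x)\<^sup>2) \<partial>mu) \<le> ennreal (pi / 2 * C)" .
  then show i: "integrable mu (\<lambda>x. (cheb_series \<alpha> x)\<^sup>2)"
    by (intro integrableI_nonneg) (auto simp: top_unique less_top[symmetric])
  show "(\<integral>x. (cheb_series \<alpha> x)\<^sup>2 \<partial>mu) \<le> pi / 2 * C"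
    using le cheb_C_nonneg by (subst (asm) nn_integral_eq_integral[OF i]) auto
qed

text \<open>From \<open>\<bar>y\<bar> \<le> 1 / 2 + y\<^sup>2 / 2\<close> and total mass
  \<open>pi / 2\<close>. The bound involves \<open>C\<close> alone, so it is uniform along a
  sequence of wings.\<close>

lemma integral_abs_cheb_series: "(\<integral>x. \<bar>cheb_series \<alpha> x\<bar> \<partial>mu) \<le> pi / 4 * (1 + C)"
proof -
  have "(\<integral>x. \<bar>cheb_series \<alpha> x\<bar> \<partial>mu) \<le> (\<integral>x. 1 / 2 + (cheb_series \<alpha> x)\<^sup>2 / 2 \<partial>mu)"
  proof (rule integral_mono)
    show "integrable mu (\<lambda>x. \<bar>cheb_series \<alpha> x\<bar>)" using integrable_cheb_series by simp
    show "integrable mu (\<lambda>x. 1 / 2 + (cheb_series \<alpha> x)\<^sup>2 / 2)"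
      by (intro Bochner_Integration.integrable_add integral_mu_const integrable_divide_zero cheb_series_square)
    fix x
    show "\<bar>cheb_series \<alpha> x\<bar> \<le> 1 / 2 + (cheb_series \<alpha> x)\<^sup>2 / 2"
      using zero_le_power2[of "\<bar>cheb_series \<alpha> x\<bar> - 1"] unfolding power2_diff by simp
  qed
  also have "\<dots> = 1 / 2 * (pi / 2) + (\<integral>x. (cheb_series \<alpha> x)\<^sup>2 \<partial>mu) / 2"
    using Bochner_Integration.integral_add[OF integral_mu_const(2)[of "1 / 2"] integrable_divide_zero[OF cheb_series_square(1), of 2]]
    by (simp only: integral_mu_const integral_divide_zero)
  also have "\<dots> \<le> pi / 4 * (1 + C)"
    using cheb_series_square(2) by (simp add: field_simps)
  finally show ?thesis .
qed

lemma cheb_series_H: "cheb_series \<alpha> \<in> H"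
  by (intro H_I cheb_series_square cheb_series_minus) measurable

text \<open>By orthogonality every partial sum that already contains index k gives exactly
  \<open>pi / 2 * \<alpha> k\<close>, so the integrated partial sums are eventually
  constant.\<close>

lemma coef_cheb_series: "coef (2 * k) (cheb_series \<alpha>) = \<alpha> k"
proof -
  have i: "integrable mu (\<lambda>x. \<alpha> m * (chebU (2 * m) x * chebU (2 * k) x))" for m
    by (intro integrable_mu_continuous continuous_intros continuous_on_chebU)
  have "(\<lambda>j. \<integral>x. cheb_block \<alpha> j x * chebU (2 * k) x \<partial>mu) sums (\<integral>x. cheb_series \<alpha> x * chebU (2 * k) x \<partial>mu)"
    by (rule cheb_series_sums(2)[where D = "3 ^ (2 * k)"]) (auto intro: chebU_bound)
  then have "(\<lambda>J. \<Sum>j<J. \<integral>x. cheb_block \<alpha> j x * chebU (2 * k) x \<partial>mu) \<longlonglongrightarrow> (\<integral>x. cheb_series \<alpha> x * chebU (2 * k) x \<partial>mu)"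
    by (simp add: sums_def)
  moreover have "(\<lambda>J. \<Sum>j<J. \<integral>x. cheb_block \<alpha> j x * chebU (2 * k) x \<partial>mu) \<longlonglongrightarrow> pi / 2 * \<alpha> k"
  proof (rule tendsto_eventually, rule eventually_sequentiallyI[of "k + 1"])
    fix J assume J: "k + 1 \<le> J"
    have "k + 1 < 2 ^ (k + 1)" by (rule less_exp)
    also have "(2::nat) ^ (k + 1) \<le> 4 ^ (k + 1)" by (rule power_mono) auto
    also have "(4::nat) ^ (k + 1) \<le> 4 ^ J" using J by (intro power_increasing) auto
    finally have k: "k < 4 ^ J - 1" by simp
    have "(\<Sum>j<J. \<integral>x. cheb_block \<alpha> j x * chebU (2 * k) x \<partial>mu) = (\<integral>x. (\<Sum>j<J. cheb_block \<alpha> j x * chebU (2 * k) x) \<partial>mu)"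
      by (rule Bochner_Integration.integral_sum[symmetric])
         (intro integrable_mult_continuous integrable_block continuous_on_chebU)
    also have "\<dots> = (\<integral>x. (\<Sum>m<4 ^ J - 1. \<alpha> m * (chebU (2 * m) x * chebU (2 * k) x)) \<partial>mu)"
      unfolding sum_distrib_right[symmetric] sum_cheb_block
      unfolding sum_distrib_right by (simp only: mult.assoc)
    also have "\<dots> = (\<Sum>m<4 ^ J - 1. \<integral>x. \<alpha> m * (chebU (2 * m) x * chebU (2 * k) x) \<partial>mu)"
      by (rule Bochner_Integration.integral_sum) (rule i)
    also have "\<dots> = (\<Sum>m<4 ^ J - 1. if m = k then pi / 2 * \<alpha> m else 0)"
      unfolding integral_mult_right_zero chebU_orthogonal by (intro sum.cong refl) auto
    also have "\<dots> = pi / 2 * \<alpha> k" using k by simp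
    finally show "(\<Sum>j<J. \<integral>x. cheb_block \<alpha> j x * chebU (2 * k) x \<partial>mu) = pi / 2 * \<alpha> k" .
  qed
  ultimately have "(\<integral>x. cheb_series \<alpha> x * chebU (2 * k) x \<partial>mu) = pi / 2 * \<alpha> k"
    by (rule LIMSEQ_unique)
  then show ?thesis
    by (subst coef_mu) (auto simp: field_simps)
qed

end

section \<open>The bending moment as a functional of the coefficients\<close>

text \<open>A product of compact intervals is compact by Tychonoff, and sequentially compact because
  countable products of reals are first countable. This plays the part of a diagonal
  extraction.\<close>

lemma bounded_coordinates_convergent_subseq:
  fixes a :: "nat \<Rightarrow> nat \<Rightarrow> real"
  assumes "\<And>n m. \<bar>a n m\<bar> \<le> B m"
  obtains l r where "strict_mono r" "\<And>m. (\<lambda>n. a (r n) m) \<longlonglongrightarrow> l m"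
proof -
  let ?S = "PiE UNIV (\<lambda>m. {- B m..B m})"
  have "compactin (product_topology (\<lambda>_. euclidean) UNIV) ?S"
    by (subst compactin_PiE) (auto simp: compactin_euclidean_iff)
  then have "seq_compact ?S"
    by (simp add: euclidean_product_topology compactin_euclidean_iff compact_imp_seq_compact)
  moreover have "\<forall>n. a n \<in> ?S" using assms by (auto simp: abs_le_iff minus_le_iff)
  ultimately obtain l r where r: "strict_mono r" "(a \<circ> r) \<longlonglongrightarrow> l"
    unfolding seq_compact_def by blast
  have "(\<lambda>n. (a \<circ> r) n m) \<longlonglongrightarrow> l m" for m
    by (rule continuous_on_tendsto_compose[OF continuous_on_product_coordinates r(2)]) auto
  then show thesis by (intro that[OF r(1)]) (simp add: o_def)
qed

text \<open>Truncating by \<open>max 0\<close> makes the kernel continuous in \<open>\<eta>\<close> on the whole interval, so that the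
  integral over \<open>(\<xi>, 1)\<close> becomes one over \<open>(-1, 1)\<close>.\<close>
definition kern :: "real \<Rightarrow> real \<Rightarrow> real \<Rightarrow> real" where
  "kern b \<xi> \<eta> = sin (b * max 0 (\<eta> - \<xi>) / 2)"

definition moment :: "real \<Rightarrow> (real \<Rightarrow> real) \<Rightarrow> real \<Rightarrow> real" where
  "moment b f \<xi> = b / 2 * (\<integral>\<eta>. f \<eta> * kern b \<xi> \<eta> \<partial>mu)"

lemma continuous_kern: "continuous_on S (kern b \<xi>)"
  unfolding kern_def [abs_def] by (intro continuous_intros) auto

lemma kern_measurable [measurable]: "kern b \<xi> \<in> borel_measurable mu"
  by (rule continuous_mu(1)[OF continuous_kern])

lemma kern_le_1: "\<bar>kern b \<xi> \<eta>\<bar> \<le> 1"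
  by (simp add: kern_def)

lemma sin_lipschitz: "\<bar>sin x - sin y\<bar> \<le> \<bar>x - y\<bar>" for x y :: real
proof -
  have "\<bar>sin ((x - y) / 2) * cos ((x + y) / 2)\<bar> \<le> \<bar>(x - y) / 2\<bar> * 1"
    unfolding abs_mult by (intro mult_mono abs_sin_x_le_abs_x) auto
  then show ?thesis
    by (simp add: sin_diff_sin)
qed

text \<open>On the wing the truncated distance is at most 1. The estimate is uniform in \<eta>, so a
  varying span can be exchanged for its limit inside the integral.\<close>

lemma kern_lipschitz_b:
  assumes "0 \<le> \<xi>" "\<eta> \<le> 1"
  shows "\<bar>kern b \<xi> \<eta> - kern c \<xi> \<eta>\<bar> \<le> \<bar>b - c\<bar>"
proof -
  have "\<bar>kern b \<xi> \<eta> - kern c \<xi> \<eta>\<bar> \<le> \<bar>b * max 0 (\<eta> - \<xi>) / 2 - c * max 0 (\<eta> - \<xi>) / 2\<bar>"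
    unfolding kern_def by (rule sin_lipschitz)
  also have "b * max 0 (\<eta> - \<xi>) / 2 - c * max 0 (\<eta> - \<xi>) / 2 = (b - c) * (max 0 (\<eta> - \<xi>) / 2)"
    by (simp add: field_simps)
  also have "\<bar>\<dots>\<bar> = \<bar>b - c\<bar> * \<bar>max 0 (\<eta> - \<xi>) / 2\<bar>"
    by (rule abs_mult)
  also have "\<dots> \<le> \<bar>b - c\<bar> * 1" using assms by (intro mult_left_mono) auto
  finally show ?thesis by simp
qed

lemma kern_lipschitz_xi: "\<bar>kern b \<xi> \<eta> - kern b \<zeta> \<eta>\<bar> \<le> \<bar>b\<bar> * \<bar>\<xi> - \<zeta>\<bar>"
proof -
  have "\<bar>kern b \<xi> \<eta> - kern b \<zeta> \<eta>\<bar> \<le> \<bar>b * max 0 (\<eta> - \<xi>) / 2 - b * max 0 (\<eta> - \<zeta>) / 2\<bar>"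
    unfolding kern_def by (rule sin_lipschitz)
  also have "\<dots> = \<bar>b\<bar> * (\<bar>max 0 (\<eta> - \<xi>) - max 0 (\<eta> - \<zeta>)\<bar> / 2)"
    by (simp add: abs_mult[symmetric] field_simps)
  also have "\<dots> \<le> \<bar>b\<bar> * \<bar>\<xi> - \<zeta>\<bar>" by (intro mult_left_mono) (auto simp: max_def abs_if)
  finally show ?thesis .
qed

lemma Mbf_eq_moment:
  assumes f: "f \<in> borel_measurable mu" and "0 \<le> \<xi>" "\<xi> \<le> 1"
  shows "Mbf b f \<xi> = moment b f \<xi>"
proof -
  have "(\<integral>\<eta>. f \<eta> * kern b \<xi> \<eta> \<partial>mu) = (LINT \<eta>:{-1<..<1}|lborel. f \<eta> * kern b \<xi> \<eta> * sqrt (1 - \<eta>\<^sup>2))"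
    by (intro integral_mu borel_measurable_times f kern_measurable)
  also have "\<dots> = (LINT \<eta>:{\<xi>..1}|lborel. f \<eta> * sqrt (1 - \<eta>\<^sup>2) * sin (b * (\<eta> - \<xi>) / 2))"
    unfolding set_lebesgue_integral_def
  proof (rule Bochner_Integration.integral_cong[OF refl])
    fix \<eta> :: real
    \<comment> \<open>At \<open>\<eta> = 1\<close> the two domains differ but the weight vanishes;
      below \<xi> the truncation makes the kernel zero.\<close>
    consider "\<eta> = 1" | "\<eta> < \<xi>" | "\<xi> \<le> \<eta>" "\<eta> < 1" | "\<eta> > 1" by linarith
    then show "indicat_real {-1<..<1} \<eta> *\<^sub>R (f \<eta> * kern b \<xi> \<eta> * sqrt (1 - \<eta>\<^sup>2))
        = indicat_real {\<xi>..1} \<eta> *\<^sub>R (f \<eta> * sqrt (1 - \<eta>\<^sup>2) * sin (b * (\<eta> - \<xi>) / 2))"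
      by cases (use assms in \<open>auto simp: kern_def indicator_def\<close>)
  qed
  finally show ?thesis by (simp add: Mbf_def moment_def)
qed

lemma moment_bound:
  assumes "integrable mu f" "0 \<le> b"
  shows "\<bar>moment b f \<xi>\<bar> \<le> b / 2 * (\<integral>x. \<bar>f x\<bar> \<partial>mu)"
  using integrable_mult_bounded(2)[OF assms(1) kern_measurable kern_le_1] assms(2)
  unfolding moment_def abs_mult by (intro mult_mono) auto

text \<open>The integral is Lipschitz in \<xi>, hence the moment is continuous. Measurability is
  what dominated convergence over \<xi> asks for.\<close>

lemma moment_measurable:
  assumes f: "integrable mu f"
  shows "moment b f \<in> borel_measurable borel"
proof -
  let ?I = "\<integral>x. \<bar>f x\<bar> \<partial>mu"
  have "(\<bar>b\<bar> * ?I)-lipschitz_on UNIV (\<lambda>\<xi>. \<integral>\<eta>. f \<eta> * kern b \<xi> \<eta> \<partial>mu)"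
  proof (rule lipschitz_onI)
    fix \<xi> \<zeta>
    have "(\<integral>\<eta>. f \<eta> * kern b \<xi> \<eta> \<partial>mu) - (\<integral>\<eta>. f \<eta> * kern b \<zeta> \<eta> \<partial>mu) = (\<integral>\<eta>. f \<eta> * (kern b \<xi> \<eta> - kern b \<zeta> \<eta>) \<partial>mu)"
      unfolding right_diff_distrib
      by (rule Bochner_Integration.integral_diff[symmetric]; rule integrable_mult_continuous[OF f continuous_kern])
    moreover have "\<bar>\<integral>\<eta>. f \<eta> * (kern b \<xi> \<eta> - kern b \<zeta> \<eta>) \<partial>mu\<bar> \<le> (\<bar>b\<bar> * \<bar>\<xi> - \<zeta>\<bar>) * ?I"
      by (rule integrable_mult_bounded(2)[OF f]) (measurable, rule kern_lipschitz_xi)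
    ultimately show "dist (\<integral>\<eta>. f \<eta> * kern b \<xi> \<eta> \<partial>mu) (\<integral>\<eta>. f \<eta> * kern b \<zeta> \<eta> \<partial>mu) \<le> \<bar>b\<bar> * ?I * dist \<xi> \<zeta>"
      by (simp add: dist_real_def mult_ac)
  qed simp
  then have "continuous_on UNIV (\<lambda>\<xi>. \<integral>\<eta>. f \<eta> * kern b \<xi> \<eta> \<partial>mu)"
    by (rule lipschitz_on_continuous_on)
  then show ?thesis
    unfolding moment_def [abs_def]
    by (intro borel_measurable_continuous_onI continuous_intros)
qed

lemma integral_chebU_coef:
  assumes "f \<in> borel_measurable mu"
  shows "(\<integral>x. f x * chebU n x \<partial>mu) = pi / 2 * coef n f"
  using coef_mu[OF assms, of n] by (simp add: field_simps)

lemma cheb_series_coefs_converge: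
  assumes bound: "\<And>n N. (\<Sum>m<N. (2 * real m + 1) * (\<alpha> n m)\<^sup>2) \<le> C"
    and lim: "\<And>m. (\<lambda>n. \<alpha> n m) \<longlonglongrightarrow> \<beta> m"
    and bound': "\<And>N. (\<Sum>m<N. (2 * real m + 1) * (\<beta> m)\<^sup>2) \<le> C"
  shows "(\<lambda>n. \<integral>x. cheb_series (\<alpha> n) x * chebU k x \<partial>mu) \<longlonglongrightarrow> (\<integral>x. cheb_series \<beta> x * chebU k x \<partial>mu)"
proof (cases "even k")
  case True
  then obtain m where "k = 2 * m" by auto
  then show ?thesis
    using coef_cheb_series[OF bound] coef_cheb_series[OF bound'] lim
    by (auto simp: integral_chebU_coef intro!: tendsto_intros)
next
  case False
  then show ?thesis
    using coef_odd[OF cheb_series_H[OF bound]] coef_odd[OF cheb_series_H[OF bound']]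
    by (simp add: integral_chebU_coef)
qed

text \<open>A wing and its series have the same coefficients, so weak convergence applied to the
  constant sequence f forces equal integrals against every continuous kernel.\<close>

lemma integral_cheb_series_eq:
  assumes f: "f \<in> H" and bound: "\<And>N. (\<Sum>m<N. (2 * real m + 1) * (coef (2 * m) f)\<^sup>2) \<le> C"
    and K: "continuous_on {-1..1} K"
  shows "(\<integral>x. cheb_series (\<lambda>m. coef (2 * m) f) x * K x \<partial>mu) = (\<integral>x. f x * K x \<partial>mu)"
proof -
  let ?g = "cheb_series (\<lambda>m. coef (2 * m) f)"
  have "coef k ?g = coef k f" for k
    using coef_odd[OF f] coef_odd[OF cheb_series_H[OF bound]] coef_cheb_series[OF bound]
    by (cases "even k") auto
  then have e: "(\<integral>x. f x * chebU k x \<partial>mu) = (\<integral>x. ?g x * chebU k x \<partial>mu)" for k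
    using H_D(1)[OF f] by (simp add: integral_chebU_coef)
  have "(\<lambda>n::nat. \<integral>x. f x * K x \<partial>mu) \<longlonglongrightarrow> (\<integral>x. ?g x * K x \<partial>mu)"
    by (rule weak_convergence[where C = "\<integral>x. \<bar>f x\<bar> \<partial>mu"])
       (use H_D[OF f] integrable_cheb_series[OF bound] K e in auto)
  then show ?thesis by (simp add: LIMSEQ_const_iff)
qed

text \<open>Density and kernel vary together. First the kernel is frozen at span c, at a cost of
  \<open>\<bar>b n - c\<bar>\<close> times the uniform L1 bound; then weak convergence handles the
  fixed kernel.\<close>

lemma moment_tendsto:
  assumes bound: "\<And>n N. (\<Sum>m<N. (2 * real m + 1) * (\<alpha> n m)\<^sup>2) \<le> C"
    and lim: "\<And>m. (\<lambda>n. \<alpha> n m) \<longlonglongrightarrow> \<beta> m"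
    and bound': "\<And>N. (\<Sum>m<N. (2 * real m + 1) * (\<beta> m)\<^sup>2) \<le> C"
    and b: "b \<longlonglongrightarrow> c" and \<xi>: "0 \<le> \<xi>"
  shows "(\<lambda>n. moment (b n) (cheb_series (\<alpha> n)) \<xi>) \<longlonglongrightarrow> moment c (cheb_series \<beta>) \<xi>"
proof -
  let ?g = "\<lambda>n. cheb_series (\<alpha> n)" and ?D = "pi / 4 * (1 + C)"
  note int = integrable_cheb_series[OF bound]
  have lim1: "(\<lambda>n. \<integral>x. ?g n x * kern c \<xi> x \<partial>mu) \<longlonglongrightarrow> (\<integral>x. cheb_series \<beta> x * kern c \<xi> x \<partial>mu)"
    by (rule weak_convergence[where C = ?D])
       (use int integrable_cheb_series[OF bound'] integral_abs_cheb_series[OF bound] continuous_kern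
          cheb_series_coefs_converge[OF bound lim bound'] in auto)
  have lim2: "(\<lambda>n. (\<integral>x. ?g n x * kern (b n) \<xi> x \<partial>mu) - (\<integral>x. ?g n x * kern c \<xi> x \<partial>mu)) \<longlonglongrightarrow> 0"
  proof (rule tendsto_rabs_zero_cancel, rule tendsto_sandwich[OF _ _ tendsto_const])
    show "\<forall>\<^sub>F n in sequentially. \<bar>(\<integral>x. ?g n x * kern (b n) \<xi> x \<partial>mu) - (\<integral>x. ?g n x * kern c \<xi> x \<partial>mu)\<bar> \<le> \<bar>b n - c\<bar> * ?D"
    proof (rule always_eventually, rule allI)
      fix n
      have "(\<integral>x. ?g n x * kern (b n) \<xi> x \<partial>mu) - (\<integral>x. ?g n x * kern c \<xi> x \<partial>mu) = (\<integral>x. ?g n x * (kern (b n) \<xi> x - kern c \<xi> x) \<partial>mu)"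
        unfolding right_diff_distrib
        by (rule Bochner_Integration.integral_diff[symmetric]; rule integrable_mult_continuous[OF int continuous_kern])
      also have "\<bar>\<dots>\<bar> \<le> \<bar>b n - c\<bar> * (\<integral>x. \<bar>?g n x\<bar> \<partial>mu)"
        by (rule integrable_mult_bounded(2)[OF int]) (measurable, rule kern_lipschitz_b[OF \<xi>], simp)
      also have "\<dots> \<le> \<bar>b n - c\<bar> * ?D"
        by (intro mult_left_mono integral_abs_cheb_series bound) auto
      finally show "\<bar>(\<integral>x. ?g n x * kern (b n) \<xi> x \<partial>mu) - (\<integral>x. ?g n x * kern c \<xi> x \<partial>mu)\<bar> \<le> \<bar>b n - c\<bar> * ?D" .
    qed
    have "(\<lambda>n. \<bar>b n - c\<bar> * ?D) \<longlonglongrightarrow> \<bar>c - c\<bar> * ?D"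
      by (intro tendsto_intros b)
    then show "(\<lambda>n. \<bar>b n - c\<bar> * ?D) \<longlonglongrightarrow> 0" by simp
  qed simp
  have "(\<lambda>n. b n / 2 * (((\<integral>x. ?g n x * kern (b n) \<xi> x \<partial>mu) - (\<integral>x. ?g n x * kern c \<xi> x \<partial>mu)) + (\<integral>x. ?g n x * kern c \<xi> x \<partial>mu)))
      \<longlonglongrightarrow> c / 2 * (0 + (\<integral>x. cheb_series \<beta> x * kern c \<xi> x \<partial>mu))"
    by (intro tendsto_intros b lim1 lim2) simp
  then show ?thesis by (simp add: moment_def)
qed

text \<open>A sum of nonnegative terms is bounded exactly when its partial sums are. Each of these
  involves finitely many coefficients and so passes to coordinatewise limits: this is the lower
  semicontinuity of the drag.\<close>

lemma drag_le_iff: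
  assumes "0 \<le> D"
  shows "drag f \<le> ennreal D \<longleftrightarrow> (\<forall>N. (\<Sum>m<N. (2 * real m + 1) * (coef (2 * m) f)\<^sup>2) \<le> 8 / pi * D)"
proof -
  let ?t = "\<lambda>m. pi / 8 * (2 * real m + 1) * (coef (2 * m) f)\<^sup>2"
  have fin: "(\<Sum>m<N. ennreal (?t m)) \<le> ennreal D \<longleftrightarrow> (\<Sum>m<N. (2 * real m + 1) * (coef (2 * m) f)\<^sup>2) \<le> 8 / pi * D" for N
  proof -
    have "(\<Sum>m<N. ?t m) = pi / 8 * (\<Sum>m<N. (2 * real m + 1) * (coef (2 * m) f)\<^sup>2)"
      by (simp add: sum_distrib_left mult_ac)
    moreover have "(\<Sum>m<N. ennreal (?t m)) = ennreal (\<Sum>m<N. ?t m)"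
      by (rule sum_ennreal) auto
    moreover have "pi / 8 * S \<le> D \<longleftrightarrow> S \<le> 8 / pi * D" for S
      by (simp add: field_simps)
    ultimately show ?thesis
      using assms by (simp only: ennreal_le_iff)
  qed
  show ?thesis
    unfolding drag_def fin[symmetric]
    by (meson order_trans sum_le_suminf summableI suminf_le_const finite_lessThan zero_le)
qed

section \<open>Compactness of the admissible set\<close>

text \<open>The factor \<open>h\<close> serves both integral constraints: it is 1 for the weight and
  the lever arm \<open>\<eta> - \<xi>\<close> for non-collapse.\<close>

lemma dominated_convergence_unit_interval:
  fixes M :: "nat \<Rightarrow> real \<Rightarrow> real"
  assumes meas: "\<And>n. M n \<in> borel_measurable borel" "M0 \<in> borel_measurable borel" "h \<in> borel_measurable borel"
    and bd: "\<And>n x. x \<in> {0..1} \<Longrightarrow> \<bar>M n x\<bar> \<le> R"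
    and lim: "\<And>x. x \<in> {0..1} \<Longrightarrow> (\<lambda>n. M n x) \<longlonglongrightarrow> M0 x"
    and S: "S \<in> sets borel" "S \<subseteq> {0..1}" and h: "\<And>x. x \<in> S \<Longrightarrow> \<bar>h x\<bar> \<le> 1"
  shows "(\<lambda>n. LINT x:S|lborel. M n x * h x) \<longlonglongrightarrow> (LINT x:S|lborel. M0 x * h x)"
  unfolding set_lebesgue_integral_def
proof (rule integral_dominated_convergence[where w = "\<lambda>x. indicator {0..1} x *\<^sub>R R"])
  have "set_integrable lborel {0..1} (\<lambda>x::real. R)"
    by (rule borel_integrable_atLeastAtMost') (rule continuous_on_const)
  then show "integrable lborel (\<lambda>x::real. indicat_real {0..1} x *\<^sub>R R)"
    by (simp add: set_integrable_def)
  show "AE x in lborel. (\<lambda>n. indicat_real S x *\<^sub>R (M n x * h x)) \<longlonglongrightarrow> indicat_real S x *\<^sub>R (M0 x * h x)"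
    using lim S(2) by (intro AE_I2) (auto simp: indicator_def intro!: tendsto_mult)
  show "AE x in lborel. norm (indicat_real S x *\<^sub>R (M n x * h x)) \<le> indicat_real {0..1} x *\<^sub>R R" for n
  proof (rule AE_I2)
    fix x :: real
    have "0 \<le> R" using bd[of 0 n] abs_ge_zero[of "M n 0"] by simp
    moreover have "\<bar>M n x\<bar> * \<bar>h x\<bar> \<le> R * 1" if "x \<in> S"
      using that S(2) h bd[of x n] \<open>0 \<le> R\<close> by (intro mult_mono) auto
    ultimately show "norm (indicat_real S x *\<^sub>R (M n x * h x)) \<le> indicat_real {0..1} x *\<^sub>R R"
      using S(2) by (auto simp: indicator_def abs_mult)
  qed
qed (use meas S in measurable)

lemma A2_iff_moment:
  assumes f: "f \<in> H"
  shows "(b, f) \<in> A2 b0 \<longleftrightarrow> b \<in> {0<..b0} \<and> drag f < top \<and> coef 0 f = 4 / (pi * b)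
      \<and> b * (LINT \<xi>:{0..1}|lborel. \<bar>moment b f \<xi>\<bar>) \<le> 1
      \<and> (\<forall>\<xi>\<in>{0..1}. moment b f \<xi> \<ge> 0
            \<and> moment b f \<xi> \<ge> b\<^sup>2 / 4 * (LINT \<eta>:{\<xi>..1}|lborel. moment b f \<eta> * (\<eta> - \<xi>)))"
proof -
  have M: "Mbf b f \<xi> = moment b f \<xi>" if "\<xi> \<in> {0..1}" for \<xi>
    using Mbf_eq_moment[OF H_D(1)[OF f]] that by simp
  have "(LINT \<xi>:{0..1}|lborel. \<bar>Mbf b f \<xi>\<bar>) = (LINT \<xi>:{0..1}|lborel. \<bar>moment b f \<xi>\<bar>)"
    unfolding set_lebesgue_integral_def
    by (intro Bochner_Integration.integral_cong) (auto simp: indicator_def M)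
  moreover have "(LINT \<eta>:{\<xi>..1}|lborel. Mbf b f \<eta> * (\<eta> - \<xi>)) = (LINT \<eta>:{\<xi>..1}|lborel. moment b f \<eta> * (\<eta> - \<xi>))"
    if "\<xi> \<in> {0..1}" for \<xi>
    unfolding set_lebesgue_integral_def
    using that by (intro Bochner_Integration.integral_cong) (auto simp: indicator_def M)
  ultimately show ?thesis
    using f M by (auto simp: A2_def)
qed

text \<open>Besides membership it returns the limits of the coefficients, from which sharper drag
  bounds valid on a tail can later be transferred to the limit wing.\<close>

lemma A2_limit:
  fixes b :: "nat \<Rightarrow> real" and f :: "nat \<Rightarrow> real \<Rightarrow> real"
  assumes A: "\<And>n. (b n, f n) \<in> A2 b0" and D: "\<And>n. drag (f n) \<le> ennreal D" "0 \<le> D"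
  obtains c \<beta> r where "strict_mono r" "\<And>m. (\<lambda>n. coef (2 * m) (f (r n))) \<longlonglongrightarrow> \<beta> m"
    "\<And>m. coef (2 * m) (cheb_series \<beta>) = \<beta> m" "(c, cheb_series \<beta>) \<in> A2 b0"
proof -
  define C where "C = 8 / pi * D"
  have f: "f n \<in> H" for n using A[of n] by (simp add: A2_def)
  note An = A[unfolded A2_iff_moment[OF f]]
  have bound: "(\<Sum>m<N. (2 * real m + 1) * (coef (2 * m) (f n))\<^sup>2) \<le> C" for n N
    using drag_le_iff[OF D(2)] D(1) by (simp add: C_def)
  \<comment> \<open>The span sits in coordinate 0, so a single extraction makes it converge together
    with all coefficients.\<close>
  define a where "a n m = (case m of 0 \<Rightarrow> b n | Suc k \<Rightarrow> coef (2 * k) (f n))" for n m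
  have "\<bar>a n m\<bar> \<le> max b0 (sqrt C)" for n m
  proof (cases m)
    case 0 then show ?thesis using An[of n] by (auto simp: a_def)
  next
    case (Suc k)
    have "(coef (2 * k) (f n))\<^sup>2 \<le> (\<Sum>m<Suc k. (coef (2 * m) (f n))\<^sup>2)"
      by (rule member_le_sum) auto
    also have "\<dots> \<le> C" using sum_squares_le[OF bound] .
    finally have "\<bar>coef (2 * k) (f n)\<bar> \<le> sqrt C" by (intro real_le_rsqrt) simp
    then show ?thesis by (simp add: a_def Suc)
  qed
  then obtain l r where r: "strict_mono r" and l: "\<And>m. (\<lambda>n. a (r n) m) \<longlonglongrightarrow> l m"
    by (rule bounded_coordinates_convergent_subseq[of a "\<lambda>_. max b0 (sqrt C)"]) auto
  define c where "c = l 0"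
  define \<beta> where "\<beta> m = l (Suc m)" for m
  have b: "(\<lambda>n. b (r n)) \<longlonglongrightarrow> c" and \<beta>: "\<And>m. (\<lambda>n. coef (2 * m) (f (r n))) \<longlonglongrightarrow> \<beta> m"
    using l[of 0] l[of "Suc _"] by (auto simp: a_def c_def \<beta>_def)
  have bound': "(\<Sum>m<N. (2 * real m + 1) * (\<beta> m)\<^sup>2) \<le> C" for N
    by (rule LIMSEQ_le_const2[OF tendsto_sum[OF tendsto_mult[OF tendsto_const tendsto_power[OF \<beta>]]]])
       (use bound in auto)
  let ?g = "cheb_series \<beta>"
  have gH: "?g \<in> H" using cheb_series_H[OF bound'] .
  have coefs: "coef (2 * m) ?g = \<beta> m" for m using coef_cheb_series[OF bound'] .
  have c0: "0 \<le> c" "c \<le> b0"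
  proof -
    have "0 \<le> b n" "b n \<le> b0" for n using An[of n] by auto
    then show "0 \<le> c" "c \<le> b0" by (auto intro: LIMSEQ_le_const[OF b] LIMSEQ_le_const2[OF b])
  qed
  \<comment> \<open>The lift constraint in product form survives the limit and excludes \<open>c = 0\<close>.\<close>
  have "(\<lambda>n. coef (2 * 0) (f (r n)) * b (r n)) \<longlonglongrightarrow> \<beta> 0 * c"
    by (intro tendsto_intros b \<beta>)
  moreover have "coef (2 * 0) (f (r n)) * b (r n) = 4 / pi" for n
    using An[of "r n"] by auto
  ultimately have \<beta>0: "\<beta> 0 * c = 4 / pi" by (simp add: LIMSEQ_const_iff)
  with c0 have c: "0 < c" by (cases "c = 0") auto
  \<comment> \<open>Spans are at most \<open>b0\<close> and the L1 norms of the series at most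
    \<open>pi / 4 * (1 + C)\<close>, so \<open>R\<close> dominates all moments.\<close>
  define R where "R = b0 / 2 * (pi / 4 * (1 + C))"
  define M where "M n \<xi> = moment (b (r n)) (f (r n)) \<xi>" for n \<xi>
  let ?M0 = "moment c ?g"
  have eq: "M n \<xi> = moment (b (r n)) (cheb_series (\<lambda>m. coef (2 * m) (f (r n)))) \<xi>" for n \<xi>
    unfolding M_def moment_def using integral_cheb_series_eq[OF f bound continuous_kern] by simp
  have lim: "(\<lambda>n. M n \<xi>) \<longlonglongrightarrow> ?M0 \<xi>" if "\<xi> \<in> {0..1}" for \<xi>
    unfolding eq using that by (intro moment_tendsto[OF bound \<beta> bound' b]) auto
  have Mbd: "\<bar>M n \<xi>\<bar> \<le> R" for n \<xi>
  proof -
    have bn: "0 \<le> b (r n)" "b (r n) \<le> b0" using An[of "r n"] by auto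
    have "\<bar>M n \<xi>\<bar> \<le> b (r n) / 2 * (\<integral>x. \<bar>cheb_series (\<lambda>m. coef (2 * m) (f (r n))) x\<bar> \<partial>mu)"
      unfolding eq by (rule moment_bound[OF integrable_cheb_series[OF bound] bn(1)])
    also have "\<dots> \<le> R"
      unfolding R_def using bn integral_abs_cheb_series[OF bound] by (intro mult_mono) auto
    finally show ?thesis .
  qed
  have meas: "M n \<in> borel_measurable borel" "?M0 \<in> borel_measurable borel" for n
    unfolding M_def by (intro moment_measurable H_D(3) f gH)+
  have "(\<lambda>n. b (r n) * (LINT \<xi>:{0..1}|lborel. \<bar>M n \<xi>\<bar> * 1)) \<longlonglongrightarrow> c * (LINT \<xi>:{0..1}|lborel. \<bar>?M0 \<xi>\<bar> * 1)"
    by (intro tendsto_mult b dominated_convergence_unit_interval[where R = R])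
       (use meas Mbd lim in \<open>auto intro: tendsto_rabs\<close>)
  moreover have "b (r n) * (LINT \<xi>:{0..1}|lborel. \<bar>M n \<xi>\<bar> * 1) \<le> 1" for n
    using An[of "r n"] by (simp add: M_def)
  ultimately have weight: "c * (LINT \<xi>:{0..1}|lborel. \<bar>?M0 \<xi>\<bar>) \<le> 1"
    using LIMSEQ_le_const2[of _ "c * (LINT \<xi>:{0..1}|lborel. \<bar>?M0 \<xi>\<bar> * 1)" 1] by auto
  have collapse: "0 \<le> ?M0 \<xi> \<and> c\<^sup>2 / 4 * (LINT \<eta>:{\<xi>..1}|lborel. ?M0 \<eta> * (\<eta> - \<xi>)) \<le> ?M0 \<xi>" if \<xi>: "\<xi> \<in> {0..1}" for \<xi>
  proof
    show "0 \<le> ?M0 \<xi>"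
      by (rule LIMSEQ_le_const[OF lim[OF \<xi>]]) (use An \<xi> in \<open>auto simp: M_def\<close>)
    have "(\<lambda>n. (b (r n))\<^sup>2 / 4 * (LINT \<eta>:{\<xi>..1}|lborel. M n \<eta> * (\<eta> - \<xi>)))
        \<longlonglongrightarrow> c\<^sup>2 / 4 * (LINT \<eta>:{\<xi>..1}|lborel. ?M0 \<eta> * (\<eta> - \<xi>))"
      by (intro tendsto_mult[OF tendsto_divide[OF tendsto_power[OF b] tendsto_const]] dominated_convergence_unit_interval[where R = R])
         (use meas Mbd lim \<xi> in auto)
    then show "c\<^sup>2 / 4 * (LINT \<eta>:{\<xi>..1}|lborel. ?M0 \<eta> * (\<eta> - \<xi>)) \<le> ?M0 \<xi>"
      by (rule LIMSEQ_le[OF _ lim[OF \<xi>]]) (use An \<xi> in \<open>auto simp: M_def\<close>)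
  qed
  have "drag ?g \<le> ennreal D"
    using drag_le_iff[OF D(2)] bound' coefs by (simp add: C_def)
  then have "drag ?g < top" by (rule le_less_trans) simp
  moreover have "coef 0 ?g = 4 / (pi * c)"
    using coefs[of 0] \<beta>0 c by (simp add: field_simps)
  ultimately have "(c, ?g) \<in> A2 b0"
    using weight collapse c c0 by (simp add: A2_iff_moment[OF gH])
  with r \<beta> coefs show thesis by (rule that)
qed

text \<open>The witness is a constant wing of span at most 1: its moment is nonnegative, antitone and
  bounded by 1.\<close>
lemma A2_nonempty:
  assumes "b0 > 0"
  shows "A2 b0 \<noteq> {}"
proof -
  define b where "b = min 1 b0"
  have b: "0 < b" "b \<le> 1" "b \<le> b0" using assms by (auto simp: b_def)
  \<comment> \<open>The value forced by the lift constraint. Span at most 1 keeps the argument of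
    the sine in [0, 1/2], where sine is nonnegative and increasing.\<close>
  define k where "k = 4 / (pi * b)"
  have k: "k > 0" using b by (simp add: k_def)
  let ?f = "\<lambda>_::real. k"
  have fH: "?f \<in> H"
    by (rule H_I) (auto intro: integral_mu_const(2))
  have "coef n ?f = (if n = 0 then k else 0)" for n
  proof -
    have "coef n ?f = 2 / pi * (\<integral>x. k * (chebU 0 x * chebU n x) \<partial>mu)"
      by (subst coef_mu) auto
    also have "\<dots> = (if n = 0 then k else 0)"
      unfolding integral_mult_right_zero chebU_orthogonal by simp
    finally show ?thesis .
  qed
  note coefs = this
  have "(\<Sum>m<N. (2 * real m + 1) * (coef (2 * m) ?f)\<^sup>2) \<le> k\<^sup>2" for N
  proof -
    have "(\<Sum>m<N. (2 * real m + 1) * (coef (2 * m) ?f)\<^sup>2) = (\<Sum>m<N. if m = 0 then k\<^sup>2 else 0)"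
      by (intro sum.cong) (auto simp: coefs)
    also have "\<dots> \<le> k\<^sup>2" by (simp add: sum.delta)
    finally show ?thesis .
  qed
  then have "drag ?f \<le> ennreal (pi / 8 * k\<^sup>2)"
    by (subst drag_le_iff) auto
  then have drag: "drag ?f < top" by (rule le_less_trans) simp
  have fi: "integrable mu ?f" by (rule integral_mu_const(2))
  let ?M = "moment b ?f"
  have kern_bounds: "0 \<le> kern b \<xi> \<eta>" "kern b \<xi> \<eta> \<le> b / 2" if "0 \<le> \<xi>" "\<eta> \<le> 1" for \<xi> \<eta>
  proof -
    have y: "0 \<le> b * max 0 (\<eta> - \<xi>)" using b by simp
    have "b * max 0 (\<eta> - \<xi>) \<le> b * 1" using b that by (intro mult_left_mono) auto
    then have y': "b * max 0 (\<eta> - \<xi>) \<le> b" by simp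
    show "0 \<le> kern b \<xi> \<eta>"
      unfolding kern_def using y y' b pi_gt3 by (intro sin_ge_zero) linarith+
    show "kern b \<xi> \<eta> \<le> b / 2"
      unfolding kern_def using y y' sin_x_le_x[of "b * max 0 (\<eta> - \<xi>) / 2"] by linarith
  qed
  have kern_antimono: "kern b \<zeta> \<eta> \<le> kern b \<xi> \<eta>" if "0 \<le> \<xi>" "\<xi> \<le> \<zeta>" "\<eta> \<le> 1" for \<xi> \<zeta> \<eta>
  proof -
    have "0 \<le> b * max 0 (\<eta> - \<zeta>)" using b by simp
    moreover have "b * max 0 (\<eta> - \<zeta>) \<le> b * max 0 (\<eta> - \<xi>)"
      using b that by (intro mult_left_mono) auto
    moreover have "b * max 0 (\<eta> - \<xi>) \<le> 1 * 1"
      using b that by (intro mult_mono) auto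
    ultimately show ?thesis
      unfolding kern_def using pi_gt3 by (intro sin_monotone_2pi_le) auto
  qed
  have ki: "integrable mu (\<lambda>\<eta>. k * kern b \<xi> \<eta>)" for \<xi>
    by (rule integrable_mult_continuous[OF fi continuous_kern])
  have M0: "0 \<le> ?M \<xi>" if "0 \<le> \<xi>" for \<xi>
    unfolding moment_def using that b k kern_bounds(1)
    by (intro mult_nonneg_nonneg integral_nonneg_AE AE_I2) auto
  have M1: "?M \<xi> \<le> 1" if "0 \<le> \<xi>" for \<xi>
  proof -
    have "(\<integral>\<eta>. k * kern b \<xi> \<eta> \<partial>mu) \<le> (\<integral>\<eta>. k * (b / 2) \<partial>mu)"
      by (rule integral_mono[OF ki integral_mu_const(2)])
         (use that k kern_bounds(2) in \<open>auto intro!: mult_left_mono\<close>)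
    \<comment> \<open>\<open>4 / (pi * b)\<close> times the kernel bound \<open>b / 2\<close> times
      the mass \<open>pi / 2\<close>.\<close>
    also have "\<dots> = 1"
      unfolding integral_mu_const using b by (simp add: k_def)
    finally have "b / 2 * (\<integral>\<eta>. k * kern b \<xi> \<eta> \<partial>mu) \<le> 1 * 1"
      using b k kern_bounds(1)[OF that]
      by (intro mult_mono integral_nonneg_AE AE_I2) auto
    then show ?thesis by (simp add: moment_def)
  qed
  have M_antimono: "?M \<zeta> \<le> ?M \<xi>" if "0 \<le> \<xi>" "\<xi> \<le> \<zeta>" for \<xi> \<zeta>
    unfolding moment_def using that b k kern_antimono
    by (intro mult_left_mono integral_mono[OF ki ki]) auto
  have unit_bound: "(LINT x:{s..1}|lborel. g x) \<le> B"
    if "0 \<le> s" "s \<le> 1" "0 \<le> B" "\<And>x. s \<le> x \<Longrightarrow> x \<le> 1 \<Longrightarrow> 0 \<le> g x \<and> g x \<le> B" "g \<in> borel_measurable borel" for g :: "real \<Rightarrow> real" and s B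
  proof -
    have c: "set_integrable lborel {s..1} (\<lambda>x. B)"
      by (rule borel_integrable_atLeastAtMost') (rule continuous_on_const)
    have "(LINT x:{s..1}|lborel. g x) \<le> (LINT x:{s..1}|lborel. B)"
      using that by (intro set_integral_mono set_integrable_bound[OF c] c)
        (auto simp: set_borel_measurable_def)
    also have "\<dots> = (1 - s) * B" using that by (simp add: set_lebesgue_integral_def)
    also have "\<dots> \<le> B" using that by (simp add: mult_left_le_one_le)
    finally show ?thesis .
  qed
  have meas: "?M \<in> borel_measurable borel" by (rule moment_measurable[OF fi])
  have "(LINT \<xi>:{0..1}|lborel. \<bar>?M \<xi>\<bar>) \<le> 1"
    by (rule unit_bound) (use M0 M1 meas in auto)
  then have "b * (LINT \<xi>:{0..1}|lborel. \<bar>?M \<xi>\<bar>) \<le> b * 1" using b by (intro mult_left_mono) auto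
  with b have weight: "b * (LINT \<xi>:{0..1}|lborel. \<bar>?M \<xi>\<bar>) \<le> 1" by linarith
  have collapse: "b\<^sup>2 / 4 * (LINT \<eta>:{\<xi>..1}|lborel. ?M \<eta> * (\<eta> - \<xi>)) \<le> ?M \<xi>" if \<xi>: "\<xi> \<in> {0..1}" for \<xi>
  proof -
    \<comment> \<open>Beyond \<xi> the moment is at most its value at \<xi>, and both the lever arm
      and the interval length are at most 1.\<close>
    have I: "(LINT \<eta>:{\<xi>..1}|lborel. ?M \<eta> * (\<eta> - \<xi>)) \<le> ?M \<xi>"
    proof (rule unit_bound)
      fix \<eta> assume \<eta>: "\<xi> \<le> \<eta>" "\<eta> \<le> 1"
      then have "?M \<eta> * (\<eta> - \<xi>) \<le> ?M \<xi> * 1"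
        using \<xi> M0 M_antimono by (intro mult_mono) auto
      then show "0 \<le> ?M \<eta> * (\<eta> - \<xi>) \<and> ?M \<eta> * (\<eta> - \<xi>) \<le> ?M \<xi>"
        using \<eta> \<xi> M0 by auto
    qed (use \<xi> M0 meas in auto)
    have "b\<^sup>2 / 4 * (LINT \<eta>:{\<xi>..1}|lborel. ?M \<eta> * (\<eta> - \<xi>)) \<le> b\<^sup>2 / 4 * ?M \<xi>"
      by (rule mult_left_mono[OF I]) simp
    also have "\<dots> \<le> 1 * ?M \<xi>"
      using M0 \<xi> power_le_one[of b 2] b by (intro mult_right_mono) auto
    finally show ?thesis by simp
  qed
  have "(b, ?f) \<in> A2 b0"
    unfolding A2_iff_moment[OF fH] using b drag coefs weight collapse M0 by (auto simp: k_def)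
  then show ?thesis by auto
qed

section \<open>Existence of a minimizer\<close>

theorem theorem4p1:
  fixes b0 :: real
  assumes "b0 > 0"
  shows "\<exists>(bt, ft) \<in> A2 b0. \<forall>(b, f) \<in> A2 b0. drag ft \<le> drag f"
proof -
  define I where "I = Inf (drag ` snd ` A2 b0)"
  obtain u where u: "\<And>n. u n \<in> drag ` snd ` A2 b0" "u \<longlonglongrightarrow> I"
    unfolding I_def using Inf_as_limit[of "drag ` snd ` A2 b0"] A2_nonempty[OF assms] by auto
  have "I < top"
    using Inf_lower[OF u(1)[of 0]] u(1)[of 0] by (auto simp: I_def A2_def)
  then obtain D where D: "I = ennreal D" "0 \<le> D" by (cases I) auto
  have ev: "\<forall>\<^sub>F n in sequentially. u n \<le> ennreal (D + e)" if "e > 0" for e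
    using order_tendstoD(2)[OF u(2), of "ennreal (D + e)"] that D
    by (auto simp: ennreal_less_iff elim: eventually_mono)
  \<comment> \<open>\<open>A2_limit\<close> wants one drag bound for every index, so the first N
    terms of the minimizing sequence are dropped.\<close>
  obtain N where N: "\<And>n. n \<ge> N \<Longrightarrow> u n \<le> ennreal (D + 1)"
    using ev[of 1] by (auto simp: eventually_sequentially)
  have "\<forall>n. \<exists>q. q \<in> A2 b0 \<and> drag (snd q) = u (n + N)"
  proof
    fix n
    show "\<exists>q. q \<in> A2 b0 \<and> drag (snd q) = u (n + N)"
      using u(1)[of "n + N"] by (elim imageE) metis
  qed
  then obtain p where p: "\<And>n. p n \<in> A2 b0" "\<And>n. drag (snd (p n)) = u (n + N)"
    by metis
  obtain c \<beta> r where r: "strict_mono r" "\<And>m. (\<lambda>n. coef (2 * m) (snd (p (r n)))) \<longlonglongrightarrow> \<beta> m"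
    and \<beta>: "\<And>m. coef (2 * m) (cheb_series \<beta>) = \<beta> m" "(c, cheb_series \<beta>) \<in> A2 b0"
    by (rule A2_limit[of "\<lambda>n. fst (p n)" "\<lambda>n. snd (p n)" b0 "D + 1"]) (use p N D in auto)
  \<comment> \<open>The bound \<open>D + 1\<close> only produced the limit. For each e the tail has
    drag at most \<open>D + e\<close>, and its partial sums carry this sharper bound over.\<close>
  have "drag (cheb_series \<beta>) \<le> I"
  proof (rule ennreal_le_epsilon)
    fix e :: real assume e: "0 < e"
    have "\<forall>\<^sub>F n in sequentially. drag (snd (p (r n))) \<le> ennreal (D + e)"
      using eventually_subseq[OF r(1) sequentially_offset[OF ev[OF e], of N]] by (simp add: p(2))
    then have sums: "\<forall>\<^sub>F n in sequentially. (\<Sum>m<K. (2 * real m + 1) * (coef (2 * m) (snd (p (r n))))\<^sup>2) \<le> 8 / pi * (D + e)" for K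
      using drag_le_iff[of "D + e"] D e by (auto elim: eventually_mono)
    have "(\<Sum>m<K. (2 * real m + 1) * (\<beta> m)\<^sup>2) \<le> 8 / pi * (D + e)" for K
      by (rule tendsto_upperbound[OF tendsto_sum[OF tendsto_mult[OF tendsto_const tendsto_power[OF r(2)]]] sums]) simp
    then have "drag (cheb_series \<beta>) \<le> ennreal (D + e)"
      using drag_le_iff[of "D + e"] D e \<beta>(1) by simp
    then show "drag (cheb_series \<beta>) \<le> I + ennreal e"
      using D e by simp
  qed
  moreover have "I \<le> drag f" if "(b, f) \<in> A2 b0" for b f
    unfolding I_def using that by (intro Inf_lower) force
  ultimately have "\<forall>(b, f)\<in>A2 b0. drag (cheb_series \<beta>) \<le> drag f"
    by (auto intro: order_trans)
  then show ?thesis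
    by (intro bexI[OF _ \<beta>(2)]) simp
qed

end
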